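(* Let $n\ge p$ be positive integers, let $\mathbb{E}$ be a finite-dimensional Euclidean space, let $\mathcal{A}:\mathbb{R}^{n\times p}\to\mathbb{E}$ be linear, $b\in\mathbb{E}$, $\lambda>0$, $f:\mathbb{E}\to\mathbb{R}$ strictly convex, and let $\bar X$ be a solution of $$\min_{X\in\mathbb{R}^{n\times p}} f(\mathcal{A}(X)-b)+\lambda\|X\|_*.$$ Then $\bar X$ is the unique solution of this problem if and only if $$\{X\in\mathbb{R}^{n\times p}:\mathcal{A}(X)=\mathcal{A}(\bar X),\ \|X\|_*=\|\bar X\|_*\}=\{\bar X\},$$ all of which is the case if and only if $W(\bar X)\cap\ker\mathcal{A}=\{0\}$, where, with $r:=\operatorname{rank}\bar X$ and a singular value decomposition $\bar X=\bar U\operatorname{diag}(\sigma(\bar X))\bar V^T$ ($\bar U\in O(n)$, $\bar V\in O(p)$), $$W(\bar X):=\left\{\bar U M\begin{pmatrix}I_r&0\\0&R\end{pmatrix}\bar V^T\ :\ M\in\mathbb{S}^n_+-\mathcal{S}^r_{++},\ \operatorname{tr}(M)=0,\ R\in\mathcal{V}_{n-r,p-r},\ M\begin{pmatrix}I_r&0\\0&RR^T\end{pmatrix}=M\right\}.$$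
   Context: $\|\cdot\|_*$ is the nuclear norm (sum of singular values). $\sigma(\bar X)\in\mathbb{R}^p$ is the vector of singular values in nonincreasing order and $\operatorname{diag}(\sigma(\bar X))$ is the $n\times p$ rectangular diagonal matrix with these diagonal entries. $O(k)$ is the set of orthogonal $k\times k$ matrices; $\mathbb{S}^n_+$ the positive semidefinite symmetric $n\times n$ matrices; $\mathbb{S}^r_{++}$ the positive definite symmetric $r\times r$ matrices. $\mathcal{S}^r_{++}:=\left\{\begin{pmatrix}A&0\\0&0\end{pmatrix}\in\mathbb{S}^n_+: A\in\mathbb{S}^r_{++}\right\}$, and $\mathbb{S}^n_+-\mathcal{S}^r_{++}=\{P-S:P\in\mathbb{S}^n_+,S\in\mathcal{S}^r_{++}\}$. $\mathcal{V}_{m,q}=\{R\in\mathbb{R}^{m\times q}:R^TR=I_q\}$ is the Stiefel manifold. Blocks with zero rows or columns are void: if $r=p$ then $\mathcal{V}_{n-r,0}$ consists of the empty matrix and $RR^T=0\in\mathbb{R}^{(n-r)\times(n-r)}$; if $r=0$ then $\mathcal{S}^0_{++}=\{0\}$. *)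

theory Defs
  imports
    "HOL-Analysis.Inner_Product"
    "Jordan_Normal_Form.Char_Poly"
    "Jordan_Normal_Form.DL_Rank"
begin

text \<open>
  Real \<open>n \<times> p\<close> matrices are the elements of \<open>carrier_mat n p :: real mat set\<close>; blocks with zero
  rows or columns are ordinary matrices there, so no case distinction is needed for void blocks.
\<close>

text \<open>
  \<open>X\<^sup>T X\<close> is symmetric and positive semidefinite, so its characteristic polynomial splits
  over the reals with nonnegative roots; counted with multiplicity there are \<open>dim_col X\<close> of them.
\<close>

definition singular_values :: "real mat \<Rightarrow> real list" where
  "singular_values X =
     rev (sorted_list_of_multiset (image_mset sqrt (proots (char_poly (transpose_mat X * X)))))"

definition nuclear_norm :: "real mat \<Rightarrow> real" where
  "nuclear_norm X = sum_list (singular_values X)"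

definition rect_diag :: "nat \<Rightarrow> nat \<Rightarrow> real list \<Rightarrow> real mat" where
  "rect_diag n p s = mat n p (\<lambda>(i, j). if i = j then s ! i else 0)"

definition trace_mat :: "real mat \<Rightarrow> real" where
  "trace_mat M = (\<Sum>i<dim_row M. M $$ (i, i))"

definition stiefel :: "nat \<Rightarrow> nat \<Rightarrow> real mat set" where
  "stiefel m q = {R \<in> carrier_mat m q. transpose_mat R * R = 1\<^sub>m q}"

text \<open>
  The library's \<open>orthogonal_mat\<close> only asks for pairwise orthogonal nonzero columns, hence this
  definition.
\<close>

definition orthogonal_group :: "nat \<Rightarrow> real mat set" where
  "orthogonal_group k =
     {Q \<in> carrier_mat k k. transpose_mat Q * Q = 1\<^sub>m k \<and> Q * transpose_mat Q = 1\<^sub>m k}"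

definition psd_mats :: "nat \<Rightarrow> real mat set" where
  "psd_mats n = {P \<in> carrier_mat n n. transpose_mat P = P \<and>
     (\<forall>x \<in> carrier_vec n. 0 \<le> x \<bullet> (P *\<^sub>v x))}"

definition pd_mats :: "nat \<Rightarrow> real mat set" where
  "pd_mats n = {P \<in> carrier_mat n n. transpose_mat P = P \<and>
     (\<forall>x \<in> carrier_vec n. x \<noteq> 0\<^sub>v n \<longrightarrow> 0 < x \<bullet> (P *\<^sub>v x))}"

definition pd_block_mats :: "nat \<Rightarrow> nat \<Rightarrow> real mat set" where
  "pd_block_mats n r = {S \<in> psd_mats n. \<exists>A \<in> pd_mats r.
     S = four_block_mat A (0\<^sub>m r (n - r)) (0\<^sub>m (n - r) r) (0\<^sub>m (n - r) (n - r))}"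

definition is_svd :: "nat \<Rightarrow> nat \<Rightarrow> real mat \<Rightarrow> real mat \<Rightarrow> real mat \<Rightarrow> bool" where
  "is_svd n p X U V \<longleftrightarrow> U \<in> orthogonal_group n \<and> V \<in> orthogonal_group p \<and>
     X = U * rect_diag n p (singular_values X) * transpose_mat V"

definition W_set :: "nat \<Rightarrow> nat \<Rightarrow> real mat \<Rightarrow> real mat \<Rightarrow> real mat \<Rightarrow> real mat set" where
  "W_set n p X U V = (let r = vec_space.rank n X in
     {U * M * four_block_mat (1\<^sub>m r) (0\<^sub>m r (p - r)) (0\<^sub>m (n - r) r) R * transpose_mat V | M R.
        M \<in> {P - S | P S. P \<in> psd_mats n \<and> S \<in> pd_block_mats n r} \<and>
        trace_mat M = 0 \<and>
        R \<in> stiefel (n - r) (p - r) \<and>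
        M * four_block_mat (1\<^sub>m r) (0\<^sub>m r (n - r)) (0\<^sub>m (n - r) r) (R * transpose_mat R) = M})"

definition linear_on_mats :: "nat \<Rightarrow> nat \<Rightarrow> (real mat \<Rightarrow> 'e::real_vector) \<Rightarrow> bool" where
  "linear_on_mats n p \<A> \<longleftrightarrow>
     (\<forall>X \<in> carrier_mat n p. \<forall>Y \<in> carrier_mat n p. \<A> (X + Y) = \<A> X + \<A> Y) \<and>
     (\<forall>c. \<forall>X \<in> carrier_mat n p. \<A> (c \<cdot>\<^sub>m X) = c *\<^sub>R \<A> X)"

definition strictly_convex :: "('e::real_vector \<Rightarrow> real) \<Rightarrow> bool" where
  "strictly_convex f \<longleftrightarrow>
     (\<forall>x y. \<forall>t\<in>{0<..<1}. x \<noteq> y \<longrightarrow>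
        f ((1 - t) *\<^sub>R x + t *\<^sub>R y) < (1 - t) * f x + t * f y)"

definition solutions ::
  "nat \<Rightarrow> nat \<Rightarrow> (real mat \<Rightarrow> 'e::real_vector) \<Rightarrow> 'e \<Rightarrow> ('e \<Rightarrow> real) \<Rightarrow> real \<Rightarrow> real mat set" where
  "solutions n p \<A> b f reg =
     {X. is_arg_min (\<lambda>X. f (\<A> X - b) + reg * nuclear_norm X) (\<lambda>X. X \<in> carrier_mat n p) X}"

end

theory Submission
  imports Defs
begin

text \<open>
  The nuclear norm is the maximum of \<open>tr (Q\<^sup>T X)\<close> over \<open>Q\<close> in the Stiefel manifold, and \<open>Q\<close> attains it
  iff \<open>X = Q H\<close> with \<open>H\<close> positive semidefinite. If \<open>X\<close> and \<open>X0\<close> have the same norm and the midpoint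
  has norm at least as large, a maximizer \<open>Q\<close> for the midpoint is a maximizer for both. In the singular
  bases of \<open>X0\<close>, maximality for \<open>X0\<close> forces \<open>Q = diag(I\<^sub>r, R)\<close>, and then \<open>X Q\<^sup>T\<close> and \<open>X0 Q\<^sup>T\<close> are the
  matrices \<open>P\<close> and \<open>S\<close> for which \<open>M = P - S\<close> exhibits \<open>X - X0\<close> as an element of \<open>W\<close>.
  Conversely, for \<open>M = P - S\<close> and small \<open>t > 0\<close> the matrix \<open>\<Sigma>\<^sub>r + t M\<close> stays positive semidefinite, where
  \<open>\<Sigma>\<^sub>r\<close> is the diagonal \<open>n \<times> n\<close> matrix of the singular values, so
  \<open>X0 + t Z = U (\<Sigma>\<^sub>r + t M) Q V\<^sup>T\<close> is a polar form whose norm is the trace of \<open>\<Sigma>\<^sub>r\<close>.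
\<close>

subsection \<open>Matrix algebra and traces\<close>

text \<open>
  Matrix algebra with side conditions on dimensions rather than carriers, so that the simplifier can
  discharge them and use the laws as rewrite rules.
\<close>

lemma mult_assoc_dims:
  fixes A B C :: "'a::semiring_0 mat"
  shows "dim_col A = dim_row B \<Longrightarrow> dim_col B = dim_row C \<Longrightarrow> A * B * C = A * (B * C)"
  by (rule assoc_mult_mat[of _ "dim_row A" "dim_row B" _ "dim_row C" _ "dim_col C"]) auto

lemma transpose_mult_dims:
  fixes A B :: "'a::comm_semiring_0 mat"
  shows "dim_col A = dim_row B \<Longrightarrow> transpose_mat (A * B) = transpose_mat B * transpose_mat A"
  by (rule transpose_mult[of _ "dim_row A" "dim_row B" _ "dim_col B"]) auto

lemma left_distrib_dims:
  fixes A B C :: "'a::semiring_0 mat"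
  shows "dim_row A = dim_row B \<Longrightarrow> dim_col A = dim_col B \<Longrightarrow> dim_col A = dim_row C \<Longrightarrow>
    (A + B) * C = A * C + B * C"
  by (rule add_mult_distrib_mat[of _ "dim_row A" "dim_row C" _ _ "dim_col C"]) auto

lemma right_distrib_dims:
  fixes A B C :: "'a::semiring_0 mat"
  shows "dim_row B = dim_row C \<Longrightarrow> dim_col B = dim_col C \<Longrightarrow> dim_col A = dim_row B \<Longrightarrow>
    A * (B + C) = A * B + A * C"
  by (rule mult_add_distrib_mat[of _ "dim_row A" "dim_row C" _ "dim_col C"]) auto

lemma left_minus_distrib_dims:
  fixes A B C :: "'a::ring mat"
  shows "dim_row A = dim_row B \<Longrightarrow> dim_col A = dim_col B \<Longrightarrow> dim_col A = dim_row C \<Longrightarrow>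
    (A - B) * C = A * C - B * C"
  by (rule minus_mult_distrib_mat[of _ "dim_row A" "dim_row C" _ _ "dim_col C"]) auto

lemma right_minus_distrib_dims:
  fixes A B C :: "'a::ring mat"
  shows "dim_row B = dim_row C \<Longrightarrow> dim_col B = dim_col C \<Longrightarrow> dim_col A = dim_row B \<Longrightarrow>
    A * (B - C) = A * B - A * C"
  by (rule mult_minus_distrib_mat[of _ "dim_row A" "dim_row C" _ "dim_col C"]) auto

lemma smult_mult_dims:
  fixes A B :: "'a::comm_semiring_0 mat"
  shows "dim_col A = dim_row B \<Longrightarrow> c \<cdot>\<^sub>m A * B = c \<cdot>\<^sub>m (A * B)"
    and "dim_col A = dim_row B \<Longrightarrow> A * (c \<cdot>\<^sub>m B) = c \<cdot>\<^sub>m (A * B)"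
  by (auto intro!: mult_smult_assoc_mat[of _ "dim_row A" "dim_row B" _ "dim_col B"]
        mult_smult_distrib[of _ "dim_row A" "dim_row B" _ "dim_col B"])

lemma transpose_minus_dims:
  fixes A B :: "'a::ab_group_add mat"
  shows "dim_row A = dim_row B \<Longrightarrow> dim_col A = dim_col B \<Longrightarrow>
    transpose_mat (A - B) = transpose_mat A - transpose_mat B"
  by (rule eq_matI) auto

lemma one_mult_dims:
  fixes A :: "'a::semiring_1 mat"
  shows "dim_row A = k \<Longrightarrow> 1\<^sub>m k * A = A" and "dim_col A = k \<Longrightarrow> A * 1\<^sub>m k = A"
  by auto

lemma cancel_left_dims:
  fixes A B C :: "'a::semiring_1 mat"
  assumes "A * B = 1\<^sub>m k" "dim_col A = dim_row B" "dim_row C = k"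
  shows "A * (B * C) = C"
  by (metis assms index_mult_mat(3) index_one_mat(3) mult_assoc_dims one_mult_dims(1))

lemmas mat_algebra = mult_assoc_dims transpose_mult_dims left_distrib_dims right_distrib_dims
  left_minus_distrib_dims right_minus_distrib_dims smult_mult_dims
  transpose_minus_dims one_mult_dims

lemma trace_transpose: "dim_row A = dim_col A \<Longrightarrow> trace_mat (transpose_mat A) = trace_mat A"
  by (auto simp: trace_mat_def)

lemma trace_mult:
  "dim_col A = dim_row B \<Longrightarrow> dim_col B = dim_row A \<Longrightarrow>
    trace_mat (A * B) = (\<Sum>i<dim_row A. \<Sum>j<dim_row B. A $$ (i, j) * B $$ (j, i))"
  by (auto simp: trace_mat_def scalar_prod_def lessThan_atLeast0 intro!: sum.cong)

lemma trace_mult_commute: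
  assumes "dim_col A = dim_row B" "dim_col B = dim_row A"
  shows "trace_mat (A * B) = trace_mat (B * A)"
  using assms by (simp add: trace_mult) (subst sum.swap, simp add: mult.commute)

lemma trace_add: "dim_row A = dim_row B \<Longrightarrow> dim_row A = dim_col A \<Longrightarrow> dim_row B = dim_col B \<Longrightarrow>
    trace_mat (A + B) = trace_mat A + trace_mat B"
  and trace_minus: "dim_row A = dim_row B \<Longrightarrow> dim_row A = dim_col A \<Longrightarrow> dim_row B = dim_col B \<Longrightarrow>
    trace_mat (A - B) = trace_mat A - trace_mat B"
  and trace_smult: "dim_row A = dim_col A \<Longrightarrow> trace_mat (c \<cdot>\<^sub>m A) = c * trace_mat A"
  by (auto simp: trace_mat_def sum.distrib sum_subtractf sum_distrib_left)

lemma trace_gram: "trace_mat (transpose_mat A * A) = (\<Sum>i<dim_col A. \<Sum>j<dim_row A. (A $$ (j, i))\<^sup>2)"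
  by (simp add: trace_mult power2_eq_square)

lemma trace_gram_nonneg: "0 \<le> trace_mat (transpose_mat A * A)"
  by (simp add: trace_gram sum_nonneg)

lemma trace_gram_eq_0: "trace_mat (transpose_mat A * A) = 0 \<Longrightarrow> A = 0\<^sub>m (dim_row A) (dim_col A)"
  by (rule eq_matI) (auto simp: trace_gram sum_nonneg_eq_0_iff sum_nonneg)

section \<open>Orthonormal columns and a trace inequality for Gram matrices\<close>

lemma stiefelD:
  "Q \<in> stiefel n p \<Longrightarrow> dim_row Q = n"
  "Q \<in> stiefel n p \<Longrightarrow> dim_col Q = p"
  "Q \<in> stiefel n p \<Longrightarrow> transpose_mat Q * Q = 1\<^sub>m p"
  by (auto simp: stiefel_def)

lemma stiefel_cancel: "Q \<in> stiefel n p \<Longrightarrow> dim_row A = p \<Longrightarrow> transpose_mat Q * (Q * A) = A"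
  by (rule cancel_left_dims) (auto dest: stiefelD)

text \<open>The left side is the squared Frobenius norm of \<open>D\<close>, the product of
  \<open>Q - K\<close> with \<open>transpose_mat C\<close>. Orthonormality turns both square terms
  into \<open>C * transpose_mat C\<close>, and the two cross terms are transposes of each other,
  hence of equal trace.\<close>

lemma gram_diff_trace:
  assumes Q: "Q \<in> stiefel n p" and K: "K \<in> stiefel n p" and C: "dim_col C = p"
  defines "D \<equiv> Q * transpose_mat C - K * transpose_mat C"
  shows "trace_mat (transpose_mat D * D) =
    2 * (trace_mat (transpose_mat C * C) - trace_mat (transpose_mat Q * (K * (transpose_mat C * C))))"
proof -
  note d[simp] = stiefelD(1,2)[OF Q] stiefelD(1,2)[OF K] C
  have "transpose_mat D * D = C * transpose_mat C - C * (transpose_mat K * (Q * transpose_mat C))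
      - (C * (transpose_mat Q * (K * transpose_mat C)) - C * transpose_mat C)"
    unfolding D_def
    by (simp add: mat_algebra stiefel_cancel[OF Q] stiefel_cancel[OF K])
  moreover have "trace_mat (C * (transpose_mat Q * (K * transpose_mat C))) =
     trace_mat (transpose_mat Q * (K * (transpose_mat C * C)))"
    by (subst trace_mult_commute) (simp_all add: mat_algebra)
  moreover have "trace_mat (C * (transpose_mat K * (Q * transpose_mat C))) =
     trace_mat (C * (transpose_mat Q * (K * transpose_mat C)))"
    by (subst trace_transpose[symmetric]) (simp_all add: mat_algebra)
  moreover have "trace_mat (C * transpose_mat C) = trace_mat (transpose_mat C * C)"
    by (rule trace_mult_commute) auto
  ultimately show ?thesis by (simp add: trace_minus)
qed

text \<open>The gap between the two sides is half a squared Frobenius norm. This is the upper bound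
  in the duality for the nuclear norm, with \<open>K\<close> as polar factor.\<close>

lemma trace_stiefel_gram_le:
  assumes "Q \<in> stiefel n p" "K \<in> stiefel n p" "dim_col C = p"
  shows "trace_mat (transpose_mat Q * (K * (transpose_mat C * C))) \<le> trace_mat (transpose_mat C * C)"
  using gram_diff_trace[OF assms] trace_gram_nonneg[of "Q * transpose_mat C - K * transpose_mat C"]
  by simp

text \<open>In the equality case the squared norm vanishes, so \<open>Q\<close> and \<open>K\<close>
  agree on the column space of \<open>transpose_mat C\<close>. A maximizer can therefore replace the
  original polar factor.\<close>

lemma trace_stiefel_gram_eqD:
  assumes Q: "Q \<in> stiefel n p" and K: "K \<in> stiefel n p" and C: "dim_col C = p"
    and eq: "trace_mat (transpose_mat Q * (K * (transpose_mat C * C))) = trace_mat (transpose_mat C * C)"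
  shows "Q * (transpose_mat C * C) = K * (transpose_mat C * C)"
proof -
  note d[simp] = stiefelD(1,2)[OF Q] stiefelD(1,2)[OF K] C
  have "Q * transpose_mat C - K * transpose_mat C = 0\<^sub>m n (dim_row C)"
    using trace_gram_eq_0[of "Q * transpose_mat C - K * transpose_mat C"]
    by (simp add: gram_diff_trace[OF Q K C] eq)
  then have "(Q * transpose_mat C) $$ ij = (K * transpose_mat C) $$ ij"
    if "fst ij < n" "snd ij < dim_row C" for ij
    using that by (cases ij) (auto dest!: arg_cong[of _ _ "\<lambda>A. A $$ ij"])
  then have "Q * transpose_mat C = K * transpose_mat C"
    by (intro eq_matI) auto
  then show ?thesis
    by (simp flip: mult_assoc_dims)
qed

subsection \<open>Orthonormal systems and the real spectral theorem\<close>

lemma real_vec_self_prod_nonneg: "0 \<le> (v :: real vec) \<bullet> v"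
  by (simp add: scalar_prod_def sum_nonneg)

lemma real_vec_self_prod_pos:
  fixes v :: "real vec"
  assumes "v \<in> carrier_vec n" "v \<noteq> 0\<^sub>v n"
  shows "0 < v \<bullet> v"
proof -
  obtain i where "i < n" "v $ i \<noteq> 0" using assms by (metis carrier_vecD eq_vecI index_zero_vec)
  then show ?thesis using assms(1) unfolding scalar_prod_def
    by (intro sum_pos2[of _ i]) (auto simp: zero_less_mult_iff linorder_neq_iff)
qed

text \<open>Fewer than \<open>n\<close> homogeneous equations, padded with zero rows, form a singular square system.\<close>

lemma exists_unit_orthogonal:
  fixes u :: "'i \<Rightarrow> real vec"
  assumes J: "finite J" "card J < n" and u: "\<And>i. i \<in> J \<Longrightarrow> u i \<in> carrier_vec n"
  shows "\<exists>w \<in> carrier_vec n. w \<bullet> w = 1 \<and> (\<forall>i\<in>J. u i \<bullet> w = 0)"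
proof -
  obtain xs where xs: "set xs = J" "distinct xs" using finite_distinct_list[OF J(1)] by blast
  have len: "length xs < n" using xs J(2) distinct_card by metis
  \<comment> \<open>Row \<open>length xs\<close> is singled out as the zero row that makes the
    determinant vanish; the rows before it carry the given vectors.\<close>
  define M where "M = mat\<^sub>r n n (\<lambda>i. if i = length xs then 0\<^sub>v n
    else if i < length xs then u (xs ! i) else 0\<^sub>v n)"
  have M: "M \<in> carrier_mat n n" by (simp add: M_def)
  have "det M = 0" unfolding M_def by (rule det_row_0[OF len]) (use u xs in auto)
  then obtain v where v: "v \<in> carrier_vec n" "v \<noteq> 0\<^sub>v n" "M *\<^sub>v v = 0\<^sub>v n"
    using det_0_iff_vec_prod_zero_field[OF M] by blast
  have orth: "u i \<bullet> v = 0" if "i \<in> J" for i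
  proof -
    obtain k where k: "k < length xs" "xs ! k = i" using \<open>i \<in> J\<close> xs(1)
      by (auto simp: in_set_conv_nth)
    have "row M k = u i"
      unfolding M_def using k len u[OF \<open>i \<in> J\<close>] by (subst row_mat_of_row_fun) auto
    moreover have "(M *\<^sub>v v) $ k = 0" using v(3) k len by simp
    moreover have "(M *\<^sub>v v) $ k = row M k \<bullet> v" using k len M by (intro index_mult_mat_vec) auto
    ultimately show ?thesis by simp
  qed
  have pos: "0 < v \<bullet> v"
    using v(1,2) by (rule real_vec_self_prod_pos)
  define w where "w = (1 / sqrt (v \<bullet> v)) \<cdot>\<^sub>v v"
  have "w \<in> carrier_vec n" "w \<bullet> w = 1" using v(1) pos by (auto simp: w_def field_simps)
  moreover have "\<forall>i\<in>J. u i \<bullet> w = 0" using orth u v(1) by (auto simp: w_def)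
  ultimately show ?thesis by blast
qed

text \<open>Induction on the number of indices still without a vector: fewer than \<open>n\<close>
  vectors have been placed, so a further unit vector orthogonal to them exists. The given vectors
  may occupy any subset \<open>J\<close>, because the nonzero columns of a matrix need not come
  first.\<close>

lemma extend_orthonormal:
  fixes u :: "'i \<Rightarrow> real vec"
  assumes "finite J" "J \<subseteq> I" "finite I" "card I \<le> n"
    and "\<And>i. i \<in> J \<Longrightarrow> u i \<in> carrier_vec n"
    and "\<And>i j. i \<in> J \<Longrightarrow> j \<in> J \<Longrightarrow> u i \<bullet> u j = (if i = j then 1 else 0)"
  shows "\<exists>w. (\<forall>i\<in>J. w i = u i) \<and> (\<forall>i\<in>I. w i \<in> carrier_vec n) \<and>
    (\<forall>i\<in>I. \<forall>j\<in>I. w i \<bullet> w j = (if i = j then 1 else 0))"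
  using assms
proof (induction "card (I - J)" arbitrary: J u)
  case 0
  then have "I = J" by auto
  with 0 show ?case by (intro exI[of _ u]) auto
next
  case (Suc m)
  then obtain k where k: "k \<in> I" "k \<notin> J" by (metis card.empty Diff_eq_empty_iff nat.distinct(1) subsetI)
  have "card J < card I" using k Suc.prems by (intro psubset_card_mono) auto
  then obtain x where x: "x \<in> carrier_vec n" "x \<bullet> x = 1" "\<forall>i\<in>J. u i \<bullet> x = 0"
    using exists_unit_orthogonal[of J n u] Suc.prems by auto
  have comm: "x \<bullet> u i = 0" if "i \<in> J" for i
    using x that Suc.prems(5) comm_scalar_prod[of x n "u i"] by auto
  have "m = card (I - insert k J)" using Suc.hyps(2) k Suc.prems(3)
    by (metis Diff_insert card_Diff_singleton DiffI diff_Suc_1)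
  moreover have "(u(k := x)) i \<in> carrier_vec n" if "i \<in> insert k J" for i
    using that x(1) Suc.prems(5) by auto
  moreover have "(u(k := x)) i \<bullet> (u(k := x)) j = (if i = j then 1 else 0)"
    if "i \<in> insert k J" "j \<in> insert k J" for i j
    using that x(2,3) comm Suc.prems(6)[of i j] k(2) by auto
  ultimately obtain w where w: "\<forall>i\<in>insert k J. w i = (u(k := x)) i" "\<forall>i\<in>I. w i \<in> carrier_vec n"
    "\<forall>i\<in>I. \<forall>j\<in>I. w i \<bullet> w j = (if i = j then 1 else 0)"
    using Suc.hyps(1)[of "insert k J" "u(k := x)"] Suc.prems(1-4) k(1) by blast
  have "\<forall>i\<in>J. w i = u i" using w(1) k(2) by auto
  with w(2,3) show ?case by blast
qed

lemma stiefel_mat_of_cols: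
  assumes "\<And>i. i < p \<Longrightarrow> w i \<in> carrier_vec n"
    and "\<And>i j. i < p \<Longrightarrow> j < p \<Longrightarrow> w i \<bullet> w j = (if i = j then 1 else 0)"
  shows "mat_of_cols n (map w [0..<p]) \<in> stiefel n p"
proof -
  have "transpose_mat (mat_of_cols n (map w [0..<p])) * mat_of_cols n (map w [0..<p]) = 1\<^sub>m p"
    using assms by (intro eq_matI) (auto simp: col_mat_of_cols)
  then show ?thesis by (auto simp: stiefel_def)
qed

lemma stiefel_square: "Q \<in> stiefel n n \<longleftrightarrow> Q \<in> orthogonal_group n"
  unfolding stiefel_def orthogonal_group_def
  using mat_mult_left_right_inverse[of "transpose_mat Q" n Q] by auto

text \<open>The characteristic polynomial has a complex root \<open>z\<close>, with eigenvector
  \<open>v\<close>. The Hermitian form \<open>q\<close> of \<open>A\<close> at \<open>v\<close> is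
  real by symmetry and equals \<open>z\<close> times the nonzero squared norm \<open>N\<close>, so
  \<open>z\<close> is real.\<close>

lemma real_symmetric_eigenvalue:
  fixes A :: "real mat"
  assumes A: "A \<in> carrier_mat n n" and sym: "transpose_mat A = A" and n: "0 < n"
  shows "\<exists>e. eigenvalue A e"
proof -
  let ?C = "map_mat complex_of_real A"
  have C: "?C \<in> carrier_mat n n" using A by simp
  have "degree (char_poly ?C) \<noteq> 0" using degree_monic_char_poly[OF C] n by simp
  then obtain z where z: "poly (char_poly ?C) z = 0"
    using fundamental_theorem_of_algebra constant_degree by metis
  then obtain v where v: "v \<in> carrier_vec n" "v \<noteq> 0\<^sub>v n" "?C *\<^sub>v v = z \<cdot>\<^sub>v v"
    using eigenvalue_root_char_poly[OF C] C by (auto simp: eigenvalue_def eigenvector_def)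
  have sym': "A $$ (i, j) = A $$ (j, i)" if "i < n" "j < n" for i j
    using that A sym by (metis carrier_matD index_transpose_mat(1))
  define q where "q = (\<Sum>i<n. \<Sum>j<n. cnj (v $ i) * complex_of_real (A $$ (i, j)) * v $ j)"
  define N where "N = (\<Sum>i<n. (cmod (v $ i))\<^sup>2)"
  have Cv: "(\<Sum>j<n. complex_of_real (A $$ (i, j)) * v $ j) = z * v $ i" if "i < n" for i
    using arg_cong[OF v(3), of "\<lambda>x. x $ i"] that A v(1)
    by (simp add: scalar_prod_def lessThan_atLeast0)
  have "q = (\<Sum>i<n. cnj (v $ i) * (\<Sum>j<n. complex_of_real (A $$ (i, j)) * v $ j))"
    by (simp add: q_def sum_distrib_left mult.assoc)
  also have "\<dots> = (\<Sum>i<n. z * (v $ i * cnj (v $ i)))"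
    using Cv by (intro sum.cong) (auto simp: mult_ac)
  also have "\<dots> = z * of_real N"
    by (simp add: N_def sum_distrib_left complex_norm_square del: of_real_power)
  finally have q: "q = z * of_real N" .
  have "cnj q = (\<Sum>i<n. \<Sum>j<n. v $ i * complex_of_real (A $$ (i, j)) * cnj (v $ j))"
    by (simp add: q_def)
  also have "\<dots> = (\<Sum>j<n. \<Sum>i<n. v $ i * complex_of_real (A $$ (i, j)) * cnj (v $ j))"
    by (rule sum.swap)
  also have "\<dots> = q"
    unfolding q_def using sym' by (intro sum.cong) (auto simp: mult_ac)
  finally have "cnj q = q" .
  moreover have "N \<noteq> 0"
  proof
    assume "N = 0"
    then have "\<forall>i<n. v $ i = 0" by (auto simp: N_def sum_nonneg_eq_0_iff)
    with v show False by (auto intro: eq_vecI)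
  qed
  ultimately have "cnj z = z" using q by simp
  then have "z = complex_of_real (Re z)" by (simp add: complex_eq_iff)
  with z have "poly (map_poly complex_of_real (char_poly A)) (complex_of_real (Re z)) = 0"
    using of_real_hom.char_poly_hom[OF A] by metis
  then have "poly (char_poly A) (Re z) = 0"
    by simp
  then show ?thesis using eigenvalue_root_char_poly[OF A] by blast
qed

lemma mat_diag_dims [simp]: "dim_row (mat_diag n d) = n" "dim_col (mat_diag n d) = n"
  by (auto simp: mat_diag_def)

lemma stiefel_mult: "Q \<in> stiefel n m \<Longrightarrow> R \<in> stiefel m p \<Longrightarrow> Q * R \<in> stiefel n p"
  by (auto simp: stiefel_def mat_algebra stiefel_cancel)

lemma stiefel_transpose: "Q \<in> stiefel n n \<Longrightarrow> transpose_mat Q \<in> stiefel n n"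
  by (auto simp: stiefel_square orthogonal_group_def)

lemma stiefel_right_inverse: "Q \<in> stiefel n n \<Longrightarrow> Q * transpose_mat Q = 1\<^sub>m n"
  by (auto simp: stiefel_square orthogonal_group_def)

lemma stiefel_cancel_right: "Q \<in> stiefel n n \<Longrightarrow> dim_row A = n \<Longrightarrow> Q * (transpose_mat Q * A) = A"
  by (rule cancel_left_dims) (auto simp: stiefel_right_inverse stiefelD)

lemma block_stiefel:
  assumes "R \<in> stiefel m q"
  shows "four_block_mat (1\<^sub>m r) (0\<^sub>m r q) (0\<^sub>m m r) R \<in> stiefel (r + m) (r + q)"
proof -
  have R: "R \<in> carrier_mat m q" "transpose_mat R * R = 1\<^sub>m q" using assms by (auto simp: stiefel_def)
  have "transpose_mat (four_block_mat (1\<^sub>m r) (0\<^sub>m r q) (0\<^sub>m m r) R) *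
      four_block_mat (1\<^sub>m r) (0\<^sub>m r q) (0\<^sub>m m r) R = four_block_mat (1\<^sub>m r) (0\<^sub>m r q) (0\<^sub>m q r) (1\<^sub>m q)"
    by (subst transpose_four_block_mat[of _ r r _ q _ m], (use R in auto)[4],
        subst mult_four_block_mat[of _ r r _ m _ q _ _ r _ q], (use R in auto))
  then show ?thesis using R by (auto simp: stiefel_def)
qed

text \<open>Induction on the dimension: a unit eigenvector is extended to an orthonormal basis
  \<open>Q\<close>, in which \<open>A\<close> splits off a one-dimensional block; the induction
  hypothesis diagonalizes the remaining symmetric block.\<close>

lemma real_spectral:
  fixes A :: "real mat"
  assumes "A \<in> carrier_mat n n" "transpose_mat A = A"
  shows "\<exists>V \<in> stiefel n n. \<exists>d. A = V * mat_diag n d * transpose_mat V"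
  using assms
proof (induction n arbitrary: A)
  case 0
  have "1\<^sub>m 0 \<in> stiefel 0 0" by (simp add: stiefel_def)
  moreover have "A = 1\<^sub>m 0 * mat_diag 0 (\<lambda>_. 0) * transpose_mat (1\<^sub>m 0)"
    using 0 by (intro eq_matI) auto
  ultimately show ?case by blast
next
  case (Suc n)
  note A = Suc.prems(1) and sym = Suc.prems(2)
  obtain e v where v: "v \<in> carrier_vec (Suc n)" "v \<noteq> 0\<^sub>v (Suc n)" "A *\<^sub>v v = e \<cdot>\<^sub>v v"
    using real_symmetric_eigenvalue[OF A sym] A by (auto simp: eigenvalue_def eigenvector_def)
  define u where "u = (1 / sqrt (v \<bullet> v)) \<cdot>\<^sub>v v"
  have pos: "0 < v \<bullet> v" using real_vec_self_prod_pos[OF v(1,2)] .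
  have u: "u \<in> carrier_vec (Suc n)" "u \<bullet> u = 1" using v(1) pos by (auto simp: u_def field_simps)
  have Au: "A *\<^sub>v u = e \<cdot>\<^sub>v u"
    using v A by (simp add: u_def mult_mat_vec[OF A] smult_smult_assoc mult.commute)
  obtain w where w0: "w 0 = u" and wc: "\<forall>i\<in>{..<Suc n}. w i \<in> carrier_vec (Suc n)"
    and wo: "\<forall>i\<in>{..<Suc n}. \<forall>j\<in>{..<Suc n}. w i \<bullet> w j = (if i = j then 1 else 0)"
    using extend_orthonormal[of "{0::nat}" "{..<Suc n}" "Suc n" "\<lambda>_. u"] u by auto
  define Q where "Q = mat_of_cols (Suc n) (map w [0..<Suc n])"
  have Q: "Q \<in> stiefel (Suc n) (Suc n)"
    unfolding Q_def by (rule stiefel_mat_of_cols) (use wc wo in auto)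
  note [simp] = carrier_matD[OF A] stiefelD(1,2)[OF Q]
  define B where "B = transpose_mat Q * (A * Q)"
  have Bc: "B \<in> carrier_mat (Suc n) (Suc n)" by (auto simp: B_def)
  have Bs: "transpose_mat B = B" by (simp add: B_def mat_algebra sym)
  have Bsym: "B $$ (i, j) = B $$ (j, i)" if "i < Suc n" "j < Suc n" for i j
    using that Bc Bs by (metis carrier_matD index_transpose_mat(1))
  have colQ: "col Q i = w i" if "i < Suc n" for i
    using that wc by (auto simp: Q_def simp del: upt_Suc)
  have "col (A * Q) 0 = A *\<^sub>v u"
    using colQ[of 0] w0 by (subst col_mult2[of _ "Suc n" "Suc n" _ "Suc n"]) (auto simp: A)
  then have "col (A * Q) 0 = e \<cdot>\<^sub>v w 0" using Au w0 by simp
  \<comment> \<open>Row \<open>i\<close> of \<open>transpose_mat Q\<close> is \<open>w i\<close>,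
    and \<open>A\<close> maps \<open>w 0\<close> to \<open>e\<close> times itself, so orthonormality
    determines the first column of \<open>B\<close>; symmetry then gives the first row.\<close>
  then have B0: "B $$ (i, 0) = (if i = 0 then e else 0)" if "i < Suc n" for i
  proof -
    have "B $$ (i, 0) = w i \<bullet> (e \<cdot>\<^sub>v w 0)"
      using that colQ \<open>col (A * Q) 0 = e \<cdot>\<^sub>v w 0\<close> by (simp add: B_def)
    also have "\<dots> = e * (w i \<bullet> w 0)"
      using that wc by (intro scalar_prod_smult_right) (metis carrier_vecD lessThan_iff zero_less_Suc)
    finally show ?thesis using that wo by auto
  qed
  define B' where "B' = mat n n (\<lambda>(i, j). B $$ (Suc i, Suc j))"
  have "B' \<in> carrier_mat n n" by (simp add: B'_def)
  moreover have "transpose_mat B' = B'"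
    by (rule eq_matI) (simp_all add: B'_def Bsym)
  ultimately obtain V d where V: "V \<in> stiefel n n"
    and B': "B' = V * mat_diag n d * transpose_mat V"
    using Suc.IH by blast
  note [simp] = stiefelD(1,2)[OF V]
  \<comment> \<open>\<open>F\<close> fixes the eigenvector coordinate and applies \<open>V\<close>
    to the others, so that \<open>Q * F\<close> diagonalizes \<open>A\<close>.\<close>
  define F where "F = four_block_mat (1\<^sub>m 1) (0\<^sub>m 1 n) (0\<^sub>m n 1) V"
  have F: "F \<in> stiefel (Suc n) (Suc n)" using block_stiefel[OF V, of 1] by (simp add: F_def)
  define d' where "d' = (\<lambda>i. case i of 0 \<Rightarrow> e | Suc i \<Rightarrow> d i)"
  have D: "mat_diag (Suc n) d' = four_block_mat (mat_diag 1 (\<lambda>_. e)) (0\<^sub>m 1 n) (0\<^sub>m n 1) (mat_diag n d)"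
    by (rule eq_matI) (auto simp: mat_diag_def d'_def split: nat.splits)
  have Fd: "transpose_mat F = four_block_mat (1\<^sub>m 1) (0\<^sub>m 1 n) (0\<^sub>m n 1) (transpose_mat V)"
    unfolding F_def by (subst transpose_four_block_mat[of _ 1 1 _ n _ n]) auto
  have "F * mat_diag (Suc n) d' = four_block_mat (mat_diag 1 (\<lambda>_. e)) (0\<^sub>m 1 n) (0\<^sub>m n 1) (V * mat_diag n d)"
    unfolding F_def D
    by (subst mult_four_block_mat[of _ 1 1 _ n _ n _ _ 1 _ n]) (auto simp: carrier_matI)
  then have "F * mat_diag (Suc n) d' * transpose_mat F =
      four_block_mat (mat_diag 1 (\<lambda>_. e)) (0\<^sub>m 1 n) (0\<^sub>m n 1) B'"
    unfolding Fd B'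
    by (simp add: mult_four_block_mat[of _ 1 1 _ n _ n _ _ 1 _ n] carrier_matI)
  also have "\<dots> = B"
    using Bc B0 Bsym[of 0]
    by (intro eq_matI) (auto simp: mat_diag_def B'_def)
  finally have FB: "F * mat_diag (Suc n) d' * transpose_mat F = B" .
  have "Q * F * mat_diag (Suc n) d' * transpose_mat (Q * F) = Q * B * transpose_mat Q"
    by (simp add: mat_algebra stiefelD(1,2)[OF F] flip: FB)
  moreover have "Q * B * transpose_mat Q = A"
    by (simp add: B_def mat_algebra stiefel_cancel_right[OF Q] stiefel_right_inverse[OF Q])
  ultimately show ?case using stiefel_mult[OF Q F] by metis
qed

text \<open>Orthogonal similarity preserves the characteristic polynomial, which for a diagonal
  matrix is a product of linear factors. Through this, the root-based \<open>singular_values\<close>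
  can be computed from any orthogonal diagonalization.\<close>

lemma proots_char_poly_diag:
  assumes V: "V \<in> stiefel n n" and A: "A = V * mat_diag n d * transpose_mat V"
  shows "proots (char_poly A) = mset (map d [0..<n])"
proof -
  note [simp] = stiefelD(1,2)[OF V]
  have "similar_mat A (mat_diag n d)"
    by (rule similar_matI[of _ _ V "transpose_mat V" n])
      (auto simp: A stiefelD[OF V] stiefel_right_inverse[OF V] carrier_matI mat_diag_def)
  then have "char_poly A = char_poly (mat_diag n d)" by (rule char_poly_similar)
  also have "\<dots> = (\<Prod>a\<leftarrow>diag_mat (mat_diag n d). [:- a, 1:])"
    by (rule char_poly_upper_triangular[of _ n]) (auto simp: mat_diag_def upper_triangular_def)
  also have "diag_mat (mat_diag n d) = map d [0..<n]"
    by (auto simp: diag_mat_def mat_diag_def)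
  finally have "char_poly A = (\<Prod>a\<leftarrow>map d [0..<n]. [:- a, 1:])" .
  moreover have "proots (\<Prod>a\<leftarrow>xs. [:- a, 1:]) = mset xs" for xs :: "real list"
  proof (induction xs)
    case (Cons a xs)
    have "(\<Prod>a\<leftarrow>xs. [:- a, 1:]) \<noteq> 0" by (auto simp: prod_list_zero_iff)
    then have "proots ([:- a, 1:] * (\<Prod>a\<leftarrow>xs. [:- a, 1:])) = proots [:- a, 1:] + mset xs"
      using Cons by (subst proots_mult) simp_all
    then show ?case by (simp only: list.map prod_list.Cons mset.simps proots_linear_factor) simp
  qed simp
  ultimately show ?thesis by metis
qed

subsection \<open>Positive semidefinite matrices\<close>

lemma psd_matsD:
  "P \<in> psd_mats n \<Longrightarrow> dim_row P = n"
  "P \<in> psd_mats n \<Longrightarrow> dim_col P = n"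
  "P \<in> psd_mats n \<Longrightarrow> transpose_mat P = P"
  by (auto simp: psd_mats_def)

text \<open>The quadratic form at \<open>x\<close> is that of \<open>P\<close> at
  \<open>Q *\<^sub>v x\<close>. \<open>Q\<close> may be rectangular, so this both compresses and
  enlarges psd matrices.\<close>

lemma psd_congruence:
  assumes P: "P \<in> psd_mats n" and Q: "dim_row Q = n"
  shows "transpose_mat Q * (P * Q) \<in> psd_mats (dim_col Q)"
proof -
  note [simp] = psd_matsD(1,2)[OF P] Q
  have "x \<bullet> (transpose_mat Q * (P * Q) *\<^sub>v x) = (Q *\<^sub>v x) \<bullet> (P *\<^sub>v (Q *\<^sub>v x))"
    if x: "x \<in> carrier_vec (dim_col Q)" for x
  proof -
    have c: "P \<in> carrier_mat n n" "Q \<in> carrier_mat n (dim_col Q)" "Q *\<^sub>v x \<in> carrier_vec n"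
      "P *\<^sub>v (Q *\<^sub>v x) \<in> carrier_vec n" "transpose_mat Q *\<^sub>v (P *\<^sub>v (Q *\<^sub>v x)) \<in> carrier_vec (dim_col Q)"
      by (auto intro!: carrier_matI carrier_vecI)
    have "transpose_mat Q * (P * Q) *\<^sub>v x = transpose_mat Q *\<^sub>v ((P * Q) *\<^sub>v x)"
      by (rule assoc_mult_mat_vec[OF _ mult_carrier_mat[OF c(1,2)] x]) (simp, rule c(2))
    also have "(P * Q) *\<^sub>v x = P *\<^sub>v (Q *\<^sub>v x)"
      by (rule assoc_mult_mat_vec[OF c(1,2) x])
    finally have "x \<bullet> (transpose_mat Q * (P * Q) *\<^sub>v x) = (transpose_mat Q *\<^sub>v (P *\<^sub>v (Q *\<^sub>v x))) \<bullet> x"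
      using comm_scalar_prod[OF x c(5)] by simp
    also have "\<dots> = (P *\<^sub>v (Q *\<^sub>v x)) \<bullet> (Q *\<^sub>v x)"
      by (rule transpose_vec_mult_scalar[OF c(2) x c(4)])
    finally show ?thesis using comm_scalar_prod[OF c(3,4)] by simp
  qed
  moreover have "transpose_mat (transpose_mat Q * (P * Q)) = transpose_mat Q * (P * Q)"
    by (simp add: mat_algebra psd_matsD(3)[OF P])
  moreover have "0 \<le> (Q *\<^sub>v x) \<bullet> (P *\<^sub>v (Q *\<^sub>v x))" for x
  proof -
    have "Q *\<^sub>v x \<in> carrier_vec n" by (rule carrier_vecI) simp
    then show ?thesis using P unfolding psd_mats_def by blast
  qed
  moreover have "transpose_mat Q * (P * Q) \<in> carrier_mat (dim_col Q) (dim_col Q)"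
    by (rule carrier_matI) simp_all
  ultimately show ?thesis by (simp add: psd_mats_def)
qed

lemma psd_diag_nonneg:
  assumes "P \<in> psd_mats n" "i < n"
  shows "0 \<le> P $$ (i, i)"
proof -
  have "unit_vec n i \<bullet> (P *\<^sub>v unit_vec n i) = P $$ (i, i)"
    using assms by (auto simp: psd_mats_def)
  moreover have "0 \<le> unit_vec n i \<bullet> (P *\<^sub>v unit_vec n i)"
    using assms(1) unit_vec_carrier[of n i] unfolding psd_mats_def by blast
  ultimately show ?thesis by simp
qed

lemma one_psd: "1\<^sub>m n \<in> psd_mats n"
  by (auto simp: psd_mats_def real_vec_self_prod_nonneg)

lemma gram_psd: "transpose_mat C * C \<in> psd_mats (dim_col C)"
  using psd_congruence[OF one_psd, of C] by simp

lemma mat_diag_psd: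
  assumes "\<And>i. i < n \<Longrightarrow> 0 \<le> d i"
  shows "mat_diag n d \<in> psd_mats n"
proof -
  let ?R = "mat_diag n (\<lambda>i. sqrt (d i))"
  have "transpose_mat ?R = ?R" by (auto simp: mat_diag_def intro!: eq_matI)
  moreover have "?R * ?R = mat_diag n d"
    using assms by simp (auto simp: mat_diag_def intro!: eq_matI)
  ultimately show ?thesis using gram_psd[of ?R] by simp
qed

lemma psd_spectral:
  assumes P: "P \<in> psd_mats n"
  shows "\<exists>V \<in> stiefel n n. \<exists>d. (\<forall>i<n. 0 \<le> d i) \<and> P = V * mat_diag n d * transpose_mat V"
proof -
  obtain V d where V: "V \<in> stiefel n n" and Pd: "P = V * mat_diag n d * transpose_mat V"
    using P real_spectral[of P n] by (auto simp: psd_mats_def)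
  note [simp] = stiefelD[OF V]
  have "transpose_mat V * (P * V) = mat_diag n d"
    by (simp add: Pd mat_algebra stiefel_cancel[OF V] mat_diag_def)
  then have "mat_diag n d \<in> psd_mats n" using psd_congruence[OF P, of V] by simp
  then have "0 \<le> d i" if "i < n" for i using psd_diag_nonneg that by (fastforce simp: mat_diag_def)
  with V Pd show ?thesis by blast
qed

text \<open>\<open>C\<close> is the diagonal matrix of square roots of the eigenvalues times
  \<open>transpose_mat V\<close>. This brings psd factors into the form that the trace inequality
  treats.\<close>

lemma psd_gram:
  assumes "P \<in> psd_mats n"
  shows "\<exists>C \<in> carrier_mat n n. P = transpose_mat C * C"
proof -
  obtain V d where V: "V \<in> stiefel n n" and d: "\<forall>i<n. 0 \<le> d i"
    and P: "P = V * mat_diag n d * transpose_mat V"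
    using psd_spectral[OF assms] by blast
  note [simp] = stiefelD[OF V]
  let ?S = "mat_diag n (\<lambda>i. sqrt (d i))"
  have "transpose_mat ?S = ?S" by (auto simp: mat_diag_def intro!: eq_matI)
  moreover have "?S * (?S * A) = mat_diag n d * A" if "dim_row A = n" for A
    using that d by (simp flip: mult_assoc_dims) (auto simp: mat_diag_def intro!: arg_cong2[of _ _ _ _ "(*)"] eq_matI)
  ultimately have "P = transpose_mat (?S * transpose_mat V) * (?S * transpose_mat V)"
    by (simp add: P mat_algebra)
  then show ?thesis by (intro bexI[of _ "?S * transpose_mat V"]) auto
qed

subsection \<open>Polar decomposition and duality for the nuclear norm\<close>

text \<open>The columns of \<open>Y\<close> are orthogonal with squared lengths \<open>d\<close>.
  Nonzero columns are normalized; the places of zero columns are filled by orthonormal completion,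
  for which \<open>p \<le> n\<close> leaves room. Their weight \<open>sqrt (d i)\<close> is zero, so
  any completion works.\<close>

lemma stiefel_diag_factor:
  fixes Y :: "real mat"
  assumes pn: "p \<le> n" and Y: "Y \<in> carrier_mat n p"
    and YY: "transpose_mat Y * Y = mat_diag p d"
  shows "\<exists>W \<in> stiefel n p. Y = W * mat_diag p (\<lambda>i. sqrt (d i))"
proof -
  note [simp] = carrier_matD[OF Y]
  have cc: "col Y i \<bullet> col Y j = (if i = j then d i else 0)" if "i < p" "j < p" for i j
    using arg_cong[OF YY, of "\<lambda>A. A $$ (i, j)"] that by (simp add: mat_diag_def)
  have d: "0 \<le> d i" if "i < p" for i
    using cc[OF that that] real_vec_self_prod_nonneg[of "col Y i"] by simp
  define J where "J = {i. i < p \<and> 0 < d i}"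
  define u where "u = (\<lambda>i. (1 / sqrt (d i)) \<cdot>\<^sub>v col Y i)"
  have uu: "u i \<bullet> u j = (if i = j then 1 else 0)" if "i \<in> J" "j \<in> J" for i j
    using that cc[of i j] by (auto simp: u_def J_def)
  have uc: "u i \<in> carrier_vec n" for i by (rule carrier_vecI) (simp add: u_def)
  have "finite J" "J \<subseteq> {..<p}" by (auto simp: J_def)
  then obtain w where wu: "\<forall>i\<in>J. w i = u i" and wc: "\<forall>i\<in>{..<p}. w i \<in> carrier_vec n"
    and wo: "\<forall>i\<in>{..<p}. \<forall>j\<in>{..<p}. w i \<bullet> w j = (if i = j then 1 else 0)"
    using extend_orthonormal[of J "{..<p}" n u] pn uc uu by (metis card_lessThan finite_lessThan)
  define W where "W = mat_of_cols n (map w [0..<p])"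
  have W: "W \<in> stiefel n p"
    unfolding W_def by (rule stiefel_mat_of_cols) (use wc wo in auto)
  have "W * mat_diag p (\<lambda>i. sqrt (d i)) = Y"
  proof (rule eq_matI)
    fix i j assume "i < dim_row Y" "j < dim_col Y"
    then have ij: "i < n" "j < p" by auto
    have "(W * mat_diag p (\<lambda>i. sqrt (d i))) $$ (i, j) = w j $ i * sqrt (d j)"
      using ij wc stiefelD(1,2)[OF W]
      by (subst mat_diag_mult_right[of _ n]) (auto simp: W_def mat_of_cols_index)
    also have "\<dots> = Y $$ (i, j)"
    proof (cases "0 < d j")
      case True
      then have "w j = (1 / sqrt (d j)) \<cdot>\<^sub>v col Y j" using wu ij by (auto simp: J_def u_def)
      then show ?thesis using ij True by simp
    next
      case False
      then have "d j = 0" using d[OF ij(2)] by simp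
      then have "\<not> 0 < col Y j \<bullet> col Y j" using cc[OF ij(2) ij(2)] by simp
      moreover have "col Y j \<in> carrier_vec n" by (rule carrier_vecI) simp
      ultimately have "col Y j = 0\<^sub>v n" using real_vec_self_prod_pos by blast
      then have "Y $$ (i, j) = 0" using ij by (metis carrier_matD Y index_col index_zero_vec(1))
      then show ?thesis using \<open>d j = 0\<close> by simp
    qed
    finally show "(W * mat_diag p (\<lambda>i. sqrt (d i))) $$ (i, j) = Y $$ (i, j)" .
  qed (use stiefelD[OF W] in auto)
  with W show ?thesis by metis
qed

text \<open>Multisets are compared because a diagonalization lists the eigenvalues in arbitrary
  order while \<open>singular_values\<close> is sorted.\<close>

lemma singular_values_sqrt_eigenvalues:
  assumes "V \<in> stiefel p p" "transpose_mat X * X = V * mat_diag p d * transpose_mat V"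
  shows "mset (singular_values X) = mset (map (\<lambda>i. sqrt (d i)) [0..<p])"
  unfolding singular_values_def using proots_char_poly_diag[OF assms]
  by (simp add: image_mset.compositionality comp_def flip: mset_map)

lemma singular_values_length:
  assumes "X \<in> carrier_mat n p"
  shows "length (singular_values X) = p"
proof -
  have "transpose_mat X * X \<in> psd_mats p" using gram_psd[of X] assms by simp
  then obtain V d where "V \<in> stiefel p p" "transpose_mat X * X = V * mat_diag p d * transpose_mat V"
    using psd_spectral by blast
  then show ?thesis using arg_cong[OF singular_values_sqrt_eigenvalues, of V p X d size] by simp
qed

lemma singular_values_nonneg:
  assumes "X \<in> carrier_mat n p" "i < p"
  shows "0 \<le> singular_values X ! i"
proof -
  have "transpose_mat X * X \<in> psd_mats p" using gram_psd[of X] assms by simp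
  then obtain V d where "V \<in> stiefel p p" "\<forall>i<p. 0 \<le> d i"
    "transpose_mat X * X = V * mat_diag p d * transpose_mat V"
    using psd_spectral by blast
  then have "\<forall>x \<in> set (singular_values X). 0 \<le> x"
    using arg_cong[OF singular_values_sqrt_eigenvalues, of V p X d set_mset] by auto
  then show ?thesis using assms singular_values_length by (metis nth_mem)
qed

lemma singular_values_antimono:
  assumes "i \<le> j" "j < length (singular_values X)"
  shows "singular_values X ! j \<le> singular_values X ! i"
  using assms by (auto simp: singular_values_def rev_nth intro!: sorted_nth_mono)

text \<open>Diagonalizing \<open>transpose_mat X * X\<close> by \<open>V\<close> makes the columns
  of \<open>X * V\<close> orthogonal, so \<open>X * V = W * ?S\<close> with orthonormal columns in
  \<open>W\<close>. Undoing \<open>V\<close> gives \<open>?K\<close> and \<open>?H\<close>, and the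
  trace of \<open>?H\<close> is that of \<open>?S\<close>, the sum of the singular values.\<close>

lemma polar_decomposition:
  assumes pn: "p \<le> n" and X: "X \<in> carrier_mat n p"
  shows "\<exists>K \<in> stiefel n p. \<exists>H \<in> psd_mats p. X = K * H \<and> nuclear_norm X = trace_mat H"
proof -
  note [simp] = carrier_matD[OF X]
  have "transpose_mat X * X \<in> psd_mats p" using gram_psd[of X] X by simp
  then obtain V d where V: "V \<in> stiefel p p" and d: "\<forall>i<p. 0 \<le> d i"
    and XX: "transpose_mat X * X = V * mat_diag p d * transpose_mat V"
    using psd_spectral by blast
  note [simp] = stiefelD[OF V]
  let ?S = "mat_diag p (\<lambda>i. sqrt (d i))"
  have "transpose_mat (X * V) * (X * V) = transpose_mat V * (transpose_mat X * X) * V"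
    by (simp add: mat_algebra)
  also have "\<dots> = mat_diag p d"
    unfolding XX by (simp add: mat_algebra stiefel_cancel[OF V])
  finally obtain W where W: "W \<in> stiefel n p" and XV: "X * V = W * ?S"
    using stiefel_diag_factor[OF pn, of "X * V" d] X by (auto simp: carrier_matI)
  note [simp] = stiefelD(1,2)[OF W]
  let ?K = "W * transpose_mat V"
  let ?H = "V * (?S * transpose_mat V)"
  have "X = X * V * transpose_mat V" by (simp add: mat_algebra stiefel_right_inverse[OF V])
  also have "\<dots> = ?K * ?H" by (simp add: XV mat_algebra stiefel_cancel[OF V])
  finally have "X = ?K * ?H" .
  moreover have "?K \<in> stiefel n p" using stiefel_mult[OF W stiefel_transpose[OF V]] .
  moreover have "?H \<in> psd_mats p"
  proof -
    have "?S \<in> psd_mats p" using d by (intro mat_diag_psd) simp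
    from psd_congruence[OF this, of "transpose_mat V"] show ?thesis by simp
  qed
  moreover have "nuclear_norm X = trace_mat ?H"
  proof -
    have "nuclear_norm X = sum_mset (mset (singular_values X))"
      by (simp add: nuclear_norm_def sum_mset_sum_list)
    also have "\<dots> = (\<Sum>i<p. sqrt (d i))"
      unfolding singular_values_sqrt_eigenvalues[OF V XX]
      by (simp only: sum_mset_sum_list) (simp add: interv_sum_list_conv_sum_set_nat lessThan_atLeast0)
    also have "\<dots> = trace_mat ?S" by (simp add: trace_mat_def mat_diag_def)
    also have "\<dots> = trace_mat ?H"
      using trace_mult_commute[of V "?S * transpose_mat V"] by (simp add: mat_algebra)
    finally show ?thesis .
  qed
  ultimately show ?thesis by blast
qed

lemma trace_stiefel_le_nuclear_norm:
  assumes "p \<le> n" "X \<in> carrier_mat n p" "Q \<in> stiefel n p"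
  shows "trace_mat (transpose_mat Q * X) \<le> nuclear_norm X"
proof -
  obtain K H where K: "K \<in> stiefel n p" and H: "H \<in> psd_mats p" "X = K * H" "nuclear_norm X = trace_mat H"
    using polar_decomposition[OF assms(1,2)] by blast
  obtain C where "C \<in> carrier_mat p p" "H = transpose_mat C * C" using psd_gram[OF H(1)] by blast
  then show ?thesis using trace_stiefel_gram_le[OF assms(3) K] H by simp
qed

lemma nuclear_norm_attained:
  assumes "p \<le> n" "X \<in> carrier_mat n p"
  shows "\<exists>Q \<in> stiefel n p. trace_mat (transpose_mat Q * X) = nuclear_norm X"
proof -
  obtain K H where "K \<in> stiefel n p" "H \<in> psd_mats p" "X = K * H" "nuclear_norm X = trace_mat H"
    using polar_decomposition[OF assms] by blast
  then show ?thesis by (intro bexI[of _ K]) (simp_all add: stiefel_cancel psd_matsD)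
qed

text \<open>By the equality case of the trace inequality, \<open>Q\<close> and the polar factor
  \<open>K\<close> agree on the range of \<open>H\<close>.\<close>

lemma polar_of_maximizer:
  assumes "p \<le> n" "X \<in> carrier_mat n p" "Q \<in> stiefel n p"
    and "trace_mat (transpose_mat Q * X) = nuclear_norm X"
  shows "\<exists>H \<in> psd_mats p. X = Q * H \<and> trace_mat H = nuclear_norm X"
proof -
  obtain K H where K: "K \<in> stiefel n p" and H: "H \<in> psd_mats p" "X = K * H" "nuclear_norm X = trace_mat H"
    using polar_decomposition[OF assms(1,2)] by blast
  obtain C where C: "C \<in> carrier_mat p p" "H = transpose_mat C * C" using psd_gram[OF H(1)] by blast
  then have "X = Q * H" using trace_stiefel_gram_eqD[OF assms(3) K, of C] assms(4) H by simp
  with H show ?thesis by metis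
qed

text \<open>Testing with \<open>Q\<close> itself gives one inequality; a maximizer \<open>K\<close>
  and the trace inequality give the other. Thus any polar form, not only the constructed one,
  reveals the norm as a trace.\<close>

lemma nuclear_norm_polar:
  assumes "p \<le> n" "Q \<in> stiefel n p" "H \<in> psd_mats p"
  shows "nuclear_norm (Q * H) = trace_mat H"
proof (rule antisym)
  have X: "Q * H \<in> carrier_mat n p" using assms by (auto simp: stiefelD psd_matsD intro!: carrier_matI)
  show "trace_mat H \<le> nuclear_norm (Q * H)"
    using trace_stiefel_le_nuclear_norm[OF assms(1) X assms(2)] assms
    by (simp add: stiefel_cancel psd_matsD)
  obtain C where C: "C \<in> carrier_mat p p" "H = transpose_mat C * C" using psd_gram[OF assms(3)] by blast
  obtain K where "K \<in> stiefel n p" "trace_mat (transpose_mat K * (Q * H)) = nuclear_norm (Q * H)"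
    using nuclear_norm_attained[OF assms(1) X] by blast
  then show "nuclear_norm (Q * H) \<le> trace_mat H"
    using trace_stiefel_gram_le[of K n p Q C] assms(2) C by simp
qed

subsection \<open>Rank and the block form of maximizers\<close>

text \<open>Columns of \<open>A * B\<close> are combinations of columns of \<open>A\<close>, so the
  one column space is a subspace of the other.\<close>

lemma (in vec_space) rank_mult_le:
  assumes A: "A \<in> carrier_mat n m" and B: "B \<in> carrier_mat m q"
  shows "rank (A * B) \<le> rank A"
proof -
  let ?W = "span (set (cols A))"
  have cA: "set (cols A) \<subseteq> carrier_vec n" and cAB: "set (cols (A * B)) \<subseteq> carrier_vec n"
    using A B cols_dim[of A] cols_dim[of "A * B"] by auto
  have W: "subspace class_ring ?W V" using span_is_subspace[OF cA] .
  have "set (cols (A * B)) \<subseteq> ?W"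
  proof
    fix x assume "x \<in> set (cols (A * B))"
    then obtain j where j: "j < q" "x = col (A * B) j" using B by (auto simp: cols_def)
    then have "x = A *\<^sub>v col B j" using col_mult2[OF A B] by simp
    then show "x \<in> ?W"
      using col_space_eq[OF A] j A B unfolding col_space_def by auto
  qed
  then have "span (set (cols (A * B))) \<subseteq> ?W"
    using W by (simp add: span_is_subset subspace_def)
  then have "subspace class_ring (span (set (cols (A * B)))) (vs ?W)"
    by (rule nested_subspaces[OF W span_is_subspace[OF cAB]])
  moreover have "vectorspace.fin_dim class_ring (vs ?W)" using fin_dim_span_cols[OF A] .
  moreover have "vectorspace.fin_dim class_ring (span_vs (set (cols (A * B))))"
    using fin_dim_span_cols[of "A * B" q] A B by auto
  ultimately show ?thesis unfolding rank_def
    using vectorspace.subspace_dim[OF subspace_is_vs[OF W]] by auto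
qed

lemma stiefel_entries:
  assumes Q: "Q \<in> stiefel n p" and "i < p" "j < p"
  shows "(\<Sum>k<n. Q $$ (k, i) * Q $$ (k, j)) = (if i = j then 1 else 0)"
  using arg_cong[OF stiefelD(3)[OF Q], of "\<lambda>A. A $$ (i, j)"] assms stiefelD(1,2)[OF Q]
  by (simp add: scalar_prod_def lessThan_atLeast0)

lemma stiefel_kernel:
  assumes Q: "Q \<in> stiefel n p" and v: "v \<in> carrier_vec p" "Q *\<^sub>v v = 0\<^sub>v n"
  shows "v = 0\<^sub>v p"
proof -
  have "Q \<in> carrier_mat n p" using Q by (simp add: stiefel_def)
  then have "transpose_mat Q *\<^sub>v (Q *\<^sub>v v) = (transpose_mat Q * Q) *\<^sub>v v"
    using v(1) by (intro assoc_mult_mat_vec[symmetric]) auto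
  moreover have "transpose_mat Q *\<^sub>v 0\<^sub>v n = 0\<^sub>v p"
    by (rule eq_vecI) (use stiefelD[OF Q] in auto)
  ultimately show ?thesis using v stiefelD[OF Q] by simp
qed

lemma stiefel_rank:
  assumes Q: "Q \<in> stiefel n k"
  shows "vec_space.rank n Q = k"
proof -
  interpret vec_space "TYPE(real)" n .
  have Qc: "Q \<in> carrier_mat n k" using Q by (simp add: stiefel_def)
  have "distinct (cols Q)"
  proof (rule distinct_conv_nth[THEN iffD2], intro allI impI notI)
    fix i j assume ij: "i < length (cols Q)" "j < length (cols Q)" "i \<noteq> j" "cols Q ! i = cols Q ! j"
    then have "col Q i = col Q j" "i < k" "j < k" using Qc by auto
    then have "Q $$ (l, i) = Q $$ (l, j)" if "l < n" for l
      using that Qc by (metis carrier_matD index_col)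
    then have "(\<Sum>l<n. Q $$ (l, i) * Q $$ (l, i)) = (\<Sum>l<n. Q $$ (l, i) * Q $$ (l, j))"
      by (intro sum.cong) auto
    then show False using stiefel_entries[OF Q] \<open>i < k\<close> \<open>j < k\<close> \<open>i \<noteq> j\<close> by simp
  qed
  then show ?thesis
    using lin_indpt_full_rank[OF Qc] lin_depE[OF Qc] stiefel_kernel[OF Q] by metis
qed

text \<open>The right inverse recovers \<open>F\<close> as \<open>F * G * H\<close>, so the rank of
  \<open>F * G\<close> cannot fall below that of \<open>F\<close>, which is \<open>k\<close>;
  multiplying by \<open>G\<close> cannot raise it.\<close>

lemma rank_stiefel_mult:
  assumes F: "F \<in> stiefel n k" and G: "G \<in> carrier_mat k p" and H: "H \<in> carrier_mat p k"
    and GH: "G * H = 1\<^sub>m k"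
  shows "vec_space.rank n (F * G) = k"
proof -
  interpret vec_space "TYPE(real)" n .
  have Fc: "F \<in> carrier_mat n k" using F by (simp add: stiefel_def)
  have "F * G * H = F" using Fc G H GH by (simp add: mult_assoc_dims)
  then have "k \<le> rank (F * G)"
    using rank_mult_le[of "F * G" p H k] Fc G H stiefel_rank[OF F] by simp
  moreover have "rank (F * G) \<le> k" using rank_mult_le[OF Fc G] stiefel_rank[OF F] by simp
  ultimately show ?thesis by simp
qed

text \<open>The condition \<open>i < b\<close> records that diagonal positions beyond the inner
  dimension receive nothing.\<close>

lemma rect_diag_mult:
  fixes s t :: "nat \<Rightarrow> 'a::semiring_0"
  shows "mat a b (\<lambda>(i, j). if i = j then s i else 0) * mat b c (\<lambda>(i, j). if i = j then t i else 0) =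
    mat a c (\<lambda>(i, j). if i = j \<and> i < b then s i * t i else 0)"
proof (rule eq_matI)
  fix i j assume "i < dim_row (mat a c (\<lambda>(i, j). if i = j \<and> i < b then s i * t i else 0))"
    "j < dim_col (mat a c (\<lambda>(i, j). if i = j \<and> i < b then s i * t i else 0))"
  then have ij: "i < a" "j < c" by auto
  have "(mat a b (\<lambda>(i, j). if i = j then s i else 0) *
      mat b c (\<lambda>(i, j). if i = j then t i else 0)) $$ (i, j) =
      (\<Sum>k\<in>{0..<b}. (if i = k then s i else 0) * (if k = j then t k else 0))"
    using ij by (auto simp: scalar_prod_def intro!: sum.cong)
  also have "\<dots> = (\<Sum>k\<in>{0..<b}. if k = i then (if i = j then s i * t i else 0) else 0)"
    by (intro sum.cong) auto
  also have "\<dots> = (if i = j \<and> i < b then s i * t i else 0)" by (simp add: sum.delta)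
  finally show "(mat a b (\<lambda>(i, j). if i = j then s i else 0) *
      mat b c (\<lambda>(i, j). if i = j then t i else 0)) $$ (i, j) =
    mat a c (\<lambda>(i, j). if i = j \<and> i < b then s i * t i else 0) $$ (i, j)"
    using ij by simp
qed simp_all

lemma is_svdD:
  assumes "is_svd n p X U V"
  shows "U \<in> stiefel n n" "V \<in> stiefel p p"
    "X = U * rect_diag n p (singular_values X) * transpose_mat V"
  using assms by (simp_all add: is_svd_def stiefel_square)

text \<open>By monotonicity the positive singular values form an initial segment, of some length
  \<open>k\<close>. Factoring the rectangular diagonal matrix through dimension \<open>k\<close>
  shows that the rank is \<open>k\<close>.\<close>

lemma singular_values_pos_iff:
  assumes pn: "p \<le> n" and X: "X \<in> carrier_mat n p" and svd: "is_svd n p X U V"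
  shows "vec_space.rank n X \<le> p \<and> (\<forall>i<p. 0 < singular_values X ! i \<longleftrightarrow> i < vec_space.rank n X)"
proof -
  let ?s = "singular_values X"
  note U = is_svdD(1)[OF svd] and V = is_svdD(2)[OF svd]
  note [simp] = stiefelD(1,2)[OF U] stiefelD(1,2)[OF V]
  have len: "length ?s = p" using singular_values_length[OF X] .
  have "\<exists>k\<le>p. \<forall>i<p. 0 < ?s ! i \<longleftrightarrow> i < k"
  proof (cases "\<exists>i<p. \<not> 0 < ?s ! i")
    case True
    define k where "k = (LEAST i. i < p \<and> \<not> 0 < ?s ! i)"
    have k: "k < p \<and> \<not> 0 < ?s ! k" unfolding k_def by (rule LeastI_ex) (rule True)
    have "0 < ?s ! i \<longleftrightarrow> i < k" if "i < p" for i
    proof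
      assume "i < k"
      with not_less_Least[of i "\<lambda>i. i < p \<and> \<not> 0 < ?s ! i"] that show "0 < ?s ! i"
        by (auto simp: k_def)
    next
      assume "0 < ?s ! i"
      with k show "i < k" using singular_values_antimono[of k i X] that len by fastforce
    qed
    with k show ?thesis by (intro exI[of _ k]) auto
  qed auto
  then obtain k where k: "k \<le> p" "\<forall>i<p. 0 < ?s ! i \<longleftrightarrow> i < k" by blast
  have zero: "?s ! i = 0" if "i < p" "\<not> i < k" for i
    using that k(2) singular_values_nonneg[OF X that(1)] by force
  \<comment> \<open>\<open>E\<close> consists of the first \<open>k\<close> columns of the identity
    and \<open>G\<close> of the first \<open>k\<close> rows of the diagonal matrix; \<open>H\<close>
    divides by the positive singular values and is a right inverse of \<open>G\<close>.\<close>
  define E :: "real mat" where "E = mat n k (\<lambda>(i, j). if i = j then 1 else 0)"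
  define G where "G = mat k p (\<lambda>(i, j). if i = j then ?s ! i else 0)"
  define H where "H = mat p k (\<lambda>(i, j). if i = j then 1 / ?s ! i else 0)"
  have [simp]: "dim_row E = n" "dim_col E = k" "dim_row G = k" "dim_col G = p"
    "dim_row H = p" "dim_col H = k"
    by (auto simp: E_def G_def H_def)
  have nz: "?s ! i \<noteq> 0" if "i < k" for i
  proof -
    have "0 < ?s ! i" using that k by (metis less_le_trans)
    then show ?thesis by simp
  qed
  have GH: "G * H = 1\<^sub>m k"
    unfolding G_def H_def rect_diag_mult using k(1) nz by (intro eq_matI) auto
  have "transpose_mat E = mat k n (\<lambda>(i, j). if i = j then 1 else 0)"
    by (rule eq_matI) (auto simp: E_def)
  then have "transpose_mat E * E = 1\<^sub>m k"
    unfolding E_def using k(1) pn by (simp only: rect_diag_mult) (auto intro!: eq_matI)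
  then have "E \<in> stiefel n k" by (simp add: stiefel_def E_def)
  from stiefel_mult[OF U this] have "U * E \<in> stiefel n k" .
  then have "vec_space.rank n (U * E * (G * transpose_mat V)) = k"
  proof (rule rank_stiefel_mult)
    show "G * transpose_mat V \<in> carrier_mat k p" "V * H \<in> carrier_mat p k"
      by (auto intro!: carrier_matI)
    show "G * transpose_mat V * (V * H) = 1\<^sub>m k"
      by (simp add: mult_assoc_dims stiefel_cancel[OF V] GH)
  qed
  moreover have "E * G = rect_diag n p ?s"
    unfolding E_def G_def rect_diag_mult rect_diag_def using zero by (intro eq_matI) auto
  then have "U * E * (G * transpose_mat V) = X"
    by (subst is_svdD(3)[OF svd]) (simp add: mult_assoc_dims flip: \<open>E * G = rect_diag n p ?s\<close>)
  ultimately show ?thesis using k by simp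
qed

text \<open>The trace is the sum of the \<open>s ! i\<close> weighted by the diagonal entries of
  \<open>Q\<close>, which are at most 1 since the columns are unit vectors. Equality forces entry 1
  wherever \<open>s ! i\<close> is positive; then the rest of that column vanishes, and
  orthogonality to the other columns clears the rest of the row.\<close>

lemma maximizer_block_form:
  assumes Q: "Q \<in> stiefel n p" and pn: "p \<le> n" and r: "r \<le> p"
    and s: "\<And>i. i < p \<Longrightarrow> 0 \<le> s ! i" "\<And>i. i < p \<Longrightarrow> 0 < s ! i \<longleftrightarrow> i < r"
    and tr: "trace_mat (transpose_mat Q * rect_diag n p s) = (\<Sum>i<p. s ! i)"
  shows "\<exists>R \<in> stiefel (n - r) (p - r).
    Q = four_block_mat (1\<^sub>m r) (0\<^sub>m r (p - r)) (0\<^sub>m (n - r) r) R"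
proof -
  note [simp] = stiefelD(1,2)[OF Q]
  have sq: "(\<Sum>k<n. (Q $$ (k, i))\<^sup>2) = 1" if "i < p" for i
    using stiefel_entries[OF Q that that] by (simp add: power2_eq_square)
  have le1: "Q $$ (i, i) \<le> 1" if "i < p" for i
  proof -
    have "(Q $$ (i, i))\<^sup>2 \<le> 1"
      unfolding sq[OF that, symmetric] using that pn by (intro member_le_sum) auto
    then show ?thesis using power2_le_imp_le[of "Q $$ (i, i)" 1] by simp
  qed
  have "trace_mat (transpose_mat Q * rect_diag n p s) = (\<Sum>i<p. \<Sum>j<n. Q $$ (j, i) * (if j = i then s ! j else 0))"
    by (subst trace_mult) (simp_all add: rect_diag_def)
  also have "\<dots> = (\<Sum>i<p. \<Sum>j<n. if j = i then Q $$ (i, i) * s ! i else 0)"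
    by (intro sum.cong) auto
  also have "\<dots> = (\<Sum>i<p. Q $$ (i, i) * s ! i)"
    using pn by (intro sum.cong) (auto simp: sum.delta)
  finally have "(\<Sum>i<p. (1 - Q $$ (i, i)) * s ! i) = 0"
    using tr by (simp add: algebra_simps sum_subtractf)
  then have "\<forall>i<p. (1 - Q $$ (i, i)) * s ! i = 0"
    using le1 s(1) by (subst (asm) sum_nonneg_eq_0_iff) auto
  then have diag: "Q $$ (i, i) = 1" if "i < r" for i
  proof -
    have "i < p" using that r by simp
    then have "0 < s ! i" using s(2) that by simp
    moreover have "(1 - Q $$ (i, i)) * s ! i = 0"
      using \<open>\<forall>i<p. (1 - Q $$ (i, i)) * s ! i = 0\<close> \<open>i < p\<close> by blast
    ultimately show ?thesis by simp
  qed
  have col: "Q $$ (k, i) = 0" if "i < r" "k < n" "k \<noteq> i" for k i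
  proof -
    have "(\<Sum>k<n. (Q $$ (k, i))\<^sup>2) = (Q $$ (i, i))\<^sup>2 + (\<Sum>k\<in>{..<n} - {i}. (Q $$ (k, i))\<^sup>2)"
      using that r pn by (intro sum.remove) auto
    then have "(\<Sum>k\<in>{..<n} - {i}. (Q $$ (k, i))\<^sup>2) = 0"
      using sq[of i] diag[of i] that r by simp
    then show ?thesis using that by (subst (asm) sum_nonneg_eq_0_iff) auto
  qed
  \<comment> \<open>Column \<open>i\<close> is now a coordinate vector, so its product with column
    \<open>j\<close> is the single entry \<open>Q $$ (i, j)\<close>.\<close>
  have row: "Q $$ (i, j) = 0" if "i < r" "j < p" "j \<noteq> i" for i j
  proof -
    have "(\<Sum>k<n. Q $$ (k, i) * Q $$ (k, j)) = (\<Sum>k<n. if k = i then Q $$ (i, j) else 0)"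
      using that col[of i] diag[of i] by (intro sum.cong) auto
    also have "\<dots> = Q $$ (i, j)" using that r pn by (simp add: sum.delta)
    finally show ?thesis using stiefel_entries[OF Q, of i j] that r by simp
  qed
  define R where "R = mat (n - r) (p - r) (\<lambda>(i, j). Q $$ (i + r, j + r))"
  have Rc: "R \<in> carrier_mat (n - r) (p - r)" by (simp add: R_def)
  have block: "Q = four_block_mat (1\<^sub>m r) (0\<^sub>m r (p - r)) (0\<^sub>m (n - r) r) R"
    using r pn Rc by (intro eq_matI) (auto simp: R_def diag col row)
  have "transpose_mat R * R = 1\<^sub>m (p - r)"
  proof (rule eq_matI)
    fix i j assume "i < dim_row (1\<^sub>m (p - r) :: real mat)" "j < dim_col (1\<^sub>m (p - r) :: real mat)"
    then have ij: "i < p - r" "j < p - r" by auto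
    have "(\<Sum>k<n. Q $$ (k, i + r) * Q $$ (k, j + r)) = (\<Sum>k\<in>{r..<n}. Q $$ (k, i + r) * Q $$ (k, j + r))"
      using ij by (intro sum.mono_neutral_right) (auto simp: row)
    also have "\<dots> = (\<Sum>k<n - r. Q $$ (k + r, i + r) * Q $$ (k + r, j + r))"
      using r pn sum.shift_bounds_nat_ivl[of "\<lambda>k. Q $$ (k, i + r) * Q $$ (k, j + r)" 0 r "n - r"]
      by (simp add: lessThan_atLeast0)
    finally show "(transpose_mat R * R) $$ (i, j) = 1\<^sub>m (p - r) $$ (i, j)"
      using ij stiefel_entries[OF Q, of "i + r" "j + r"]
      by (simp add: R_def scalar_prod_def lessThan_atLeast0)
  qed (simp_all add: R_def)
  then have "R \<in> stiefel (n - r) (p - r)" using Rc by (simp add: stiefel_def)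
  with block show ?thesis by blast
qed

section \<open>Quadratic forms and small perturbations\<close>

lemma quadratic_form_sum:
  fixes A :: "real mat"
  assumes "A \<in> carrier_mat n n" "x \<in> carrier_vec n"
  shows "x \<bullet> (A *\<^sub>v x) = (\<Sum>i<n. \<Sum>j<n. A $$ (i, j) * (x $ i * x $ j))"
  using assms
  by (auto simp: scalar_prod_def lessThan_atLeast0 sum_distrib_left mult_ac intro!: sum.cong)

lemma psd_add:
  assumes "P \<in> psd_mats n" "Q \<in> psd_mats n"
  shows "P + Q \<in> psd_mats n"
proof -
  have c: "P \<in> carrier_mat n n" "Q \<in> carrier_mat n n" using assms by (auto simp: psd_mats_def)
  have "x \<bullet> ((P + Q) *\<^sub>v x) = x \<bullet> (P *\<^sub>v x) + x \<bullet> (Q *\<^sub>v x)" if "x \<in> carrier_vec n" for x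
    using that c quadratic_form_sum[OF add_carrier_mat[OF c(2)] that, of P]
    by (simp add: quadratic_form_sum distrib_right sum.distrib)
  moreover have "transpose_mat (P + Q) = P + Q"
    using c assms by (simp add: psd_mats_def transpose_add)
  ultimately show ?thesis using assms c by (auto simp: psd_mats_def)
qed

lemma psd_smult:
  assumes "P \<in> psd_mats n" "0 \<le> c"
  shows "c \<cdot>\<^sub>m P \<in> psd_mats n"
proof -
  have P: "P \<in> carrier_mat n n" using assms by (auto simp: psd_mats_def)
  have "x \<bullet> ((c \<cdot>\<^sub>m P) *\<^sub>v x) = c * (x \<bullet> (P *\<^sub>v x))" if "x \<in> carrier_vec n" for x
    using that P quadratic_form_sum[OF smult_carrier_mat[OF P] that, of c]
    by (simp add: quadratic_form_sum sum_distrib_left mult.assoc)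
  moreover have "transpose_mat (c \<cdot>\<^sub>m P) = c \<cdot>\<^sub>m transpose_mat P" by (rule eq_matI) auto
  ultimately show ?thesis using assms P by (auto simp: psd_mats_def)
qed

text \<open>With \<open>N\<close> the squared length of the first \<open>r\<close> coordinates of
  \<open>x\<close>, the diagonal form is at least \<open>m * N\<close>, while the form of the block
  is at most \<open>c * N\<close>, where \<open>c\<close> sums the absolute entries of
  \<open>A\<close>. Hence any positive \<open>t\<close> with \<open>t * c \<le> m\<close>
  works.\<close>

lemma psd_minus_small_block:
  assumes A: "A \<in> carrier_mat r r" "transpose_mat A = A" and r: "r \<le> n"
    and m: "0 < m" "\<And>i. i < r \<Longrightarrow> m \<le> d i" and d: "\<And>i. i < n \<Longrightarrow> 0 \<le> d i"
  defines "S \<equiv> four_block_mat A (0\<^sub>m r (n - r)) (0\<^sub>m (n - r) r) (0\<^sub>m (n - r) (n - r))"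
  shows "\<exists>t>0. mat_diag n d - t \<cdot>\<^sub>m S \<in> psd_mats n"
proof -
  define c where "c = (\<Sum>i<r. \<Sum>j<r. \<bar>A $$ (i, j)\<bar>)"
  \<comment> \<open>The summand 1 keeps the denominator positive even if \<open>A\<close> is zero or
    empty.\<close>
  define t where "t = m / (c + 1)"
  have c: "0 \<le> c" by (simp add: c_def sum_nonneg)
  then have t: "0 < t" "t * c \<le> m" using m(1) by (auto simp: t_def field_simps)
  have dims [simp]: "dim_row S = n" "dim_col S = n" using A(1) r by (auto simp: S_def)
  have S: "S $$ (i, j) = (if i < r \<and> j < r then A $$ (i, j) else 0)" if "i < n" "j < n" for i j
    using that A(1) r by (auto simp: S_def)
  have Asym: "A $$ (i, j) = A $$ (j, i)" if "i < r" "j < r" for i j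
    using that A by (metis carrier_matD index_transpose_mat(1))
  have "0 \<le> x \<bullet> ((mat_diag n d - t \<cdot>\<^sub>m S) *\<^sub>v x)" if x: "x \<in> carrier_vec n" for x
  proof -
    define N where "N = (\<Sum>k<r. (x $ k)\<^sup>2)"
    have N: "(x $ k)\<^sup>2 \<le> N" if "k < r" for k
      unfolding N_def using that by (intro member_le_sum) auto
    have "\<bar>x $ i * x $ j\<bar> \<le> N" if "i < r" "j < r" for i j
    proof -
      have "2 * \<bar>x $ i * x $ j\<bar> \<le> (x $ i)\<^sup>2 + (x $ j)\<^sup>2"
        using sum_squares_bound[of "\<bar>x $ i\<bar>" "\<bar>x $ j\<bar>"] by (simp add: abs_mult)
      then show ?thesis using N[OF that(1)] N[OF that(2)] by simp
    qed
    then have "\<bar>A $$ (i, j)\<bar> * \<bar>x $ i * x $ j\<bar> \<le> \<bar>A $$ (i, j)\<bar> * N" if "i < r" "j < r" for i j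
      using that by (intro mult_left_mono) auto
    moreover have "A $$ (i, j) * (x $ i * x $ j) \<le> \<bar>A $$ (i, j)\<bar> * \<bar>x $ i * x $ j\<bar>" for i j
      by (metis abs_ge_self abs_mult)
    ultimately have "A $$ (i, j) * (x $ i * x $ j) \<le> \<bar>A $$ (i, j)\<bar> * N" if "i < r" "j < r" for i j
      using that order_trans by blast
    then have "(\<Sum>i<r. \<Sum>j<r. A $$ (i, j) * (x $ i * x $ j)) \<le> c * N"
      unfolding c_def sum_distrib_right by (intro sum_mono) auto
    then have "t * (\<Sum>i<r. \<Sum>j<r. A $$ (i, j) * (x $ i * x $ j)) \<le> t * (c * N)"
      using t(1) by simp
    also have "\<dots> \<le> m * N"
      using mult_right_mono[OF t(2), of N] by (simp add: N_def sum_nonneg mult.assoc)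
    also have "\<dots> \<le> (\<Sum>i<r. d i * (x $ i)\<^sup>2)"
      unfolding N_def sum_distrib_left using m(2) by (intro sum_mono mult_right_mono) auto
    also have "\<dots> \<le> (\<Sum>i<n. d i * (x $ i)\<^sup>2)"
      using r d by (intro sum_mono2) auto
    finally have le: "t * (\<Sum>i<r. \<Sum>j<r. A $$ (i, j) * (x $ i * x $ j)) \<le> (\<Sum>i<n. d i * (x $ i)\<^sup>2)" .
    have "x \<bullet> ((mat_diag n d - t \<cdot>\<^sub>m S) *\<^sub>v x) =
        (\<Sum>i<n. \<Sum>j<n. (mat_diag n d - t \<cdot>\<^sub>m S) $$ (i, j) * (x $ i * x $ j))"
      using x by (intro quadratic_form_sum) (auto intro!: carrier_matI)
    also have "\<dots> = (\<Sum>i<n. \<Sum>j<n. (if i = j then d j * (x $ j)\<^sup>2 else 0) - t * (S $$ (i, j) * (x $ i * x $ j)))"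
      by (intro sum.cong refl) (auto simp: mat_diag_def algebra_simps power2_eq_square)
    also have "\<dots> = (\<Sum>i<n. d i * (x $ i)\<^sup>2) - t * (\<Sum>i<n. \<Sum>j<n. S $$ (i, j) * (x $ i * x $ j))"
      by (simp add: sum_subtractf sum_distrib_left)
    also have "(\<Sum>i<n. \<Sum>j<n. S $$ (i, j) * (x $ i * x $ j)) =
        (\<Sum>i<r. \<Sum>j<n. S $$ (i, j) * (x $ i * x $ j))"
      using r by (intro sum.mono_neutral_right) (auto simp: S)
    also have "\<dots> = (\<Sum>i<r. \<Sum>j<r. S $$ (i, j) * (x $ i * x $ j))"
      using r by (intro sum.cong sum.mono_neutral_right) (auto simp: S)
    also have "\<dots> = (\<Sum>i<r. \<Sum>j<r. A $$ (i, j) * (x $ i * x $ j))"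
      using r by (intro sum.cong) (auto simp: S)
    finally show ?thesis using le by simp
  qed
  moreover have "transpose_mat (mat_diag n d - t \<cdot>\<^sub>m S) = mat_diag n d - t \<cdot>\<^sub>m S"
    by (rule eq_matI) (auto simp: mat_diag_def S Asym)
  ultimately have "mat_diag n d - t \<cdot>\<^sub>m S \<in> psd_mats n"
    by (auto simp: psd_mats_def intro!: carrier_matI)
  with t(1) show ?thesis by blast
qed

text \<open>Identifies the matrix in the constraint of \<open>W_set\<close> as Q Q^T for the block
  matrix Q = diag(I, R); when \<open>R\<close> has orthonormal columns, this is the orthogonal
  projection onto the column space of Q.\<close>

lemma block_form_gram:
  assumes R: "R \<in> carrier_mat m q"
  shows "four_block_mat (1\<^sub>m r) (0\<^sub>m r q) (0\<^sub>m m r) R *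
      transpose_mat (four_block_mat (1\<^sub>m r) (0\<^sub>m r q) (0\<^sub>m m r) R) =
    four_block_mat (1\<^sub>m r) (0\<^sub>m r m) (0\<^sub>m m r) (R * transpose_mat (R :: real mat))"
  by (subst transpose_four_block_mat[of _ r r _ q _ m], (use R in auto)[4],
      subst mult_four_block_mat[of _ r r _ q _ m _ _ r _ m], (use R in auto))

lemma nuclear_norm_eq_sum:
  assumes "X \<in> carrier_mat n p"
  shows "nuclear_norm X = (\<Sum>i<p. singular_values X ! i)"
  using singular_values_length[OF assms]
  by (simp add: nuclear_norm_def sum_list_sum_nth lessThan_atLeast0)

text \<open>
  A maximizer \<open>Q\<close> for the midpoint bounds both traces at once; this gives the triangle inequality,
  and equality there forces \<open>Q\<close> to be a maximizer for \<open>X\<close> and \<open>Y\<close> simultaneously.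
\<close>

lemma nuclear_norm_midpoint:
  assumes "p \<le> n" "X \<in> carrier_mat n p" "Y \<in> carrier_mat n p"
  shows "\<exists>Q \<in> stiefel n p. 2 * nuclear_norm ((1/2) \<cdot>\<^sub>m (X + Y)) =
    trace_mat (transpose_mat Q * X) + trace_mat (transpose_mat Q * Y)"
proof -
  have "(1/2) \<cdot>\<^sub>m (X + Y) \<in> carrier_mat n p" using assms by auto
  then obtain Q where Q: "Q \<in> stiefel n p"
    "trace_mat (transpose_mat Q * ((1/2) \<cdot>\<^sub>m (X + Y))) = nuclear_norm ((1/2) \<cdot>\<^sub>m (X + Y))"
    using nuclear_norm_attained[OF assms(1)] by blast
  have "transpose_mat Q * ((1/2) \<cdot>\<^sub>m (X + Y)) = (1/2) \<cdot>\<^sub>m (transpose_mat Q * X + transpose_mat Q * Y)"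
    using assms stiefelD[OF Q(1)] by (simp add: mat_algebra)
  then show ?thesis using Q assms stiefelD[OF Q(1)] trace_smult
    by (intro bexI[of _ Q]) (auto simp: trace_add trace_smult)
qed

text \<open>\<open>D\<close> is supported on the first \<open>r\<close> indices, and the first
  \<open>r\<close> rows of \<open>Q\<close> and \<open>B\<close> look like those of an identity
  matrix. This gives both products with \<open>D\<close>, since \<open>s\<close> vanishes from index
  \<open>r\<close> on.\<close>

lemma block_mult_facts:
  assumes pn: "p \<le> n" and r: "r \<le> p" and R: "R \<in> stiefel (n - r) (p - r)"
    and s: "\<forall>i. r \<le> i \<longrightarrow> i < p \<longrightarrow> s ! i = 0"
  defines "Q \<equiv> four_block_mat (1\<^sub>m r) (0\<^sub>m r (p - r)) (0\<^sub>m (n - r) r) R"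
    and "B \<equiv> four_block_mat (1\<^sub>m r) (0\<^sub>m r (n - r)) (0\<^sub>m (n - r) r) (R * transpose_mat R)"
    and "D \<equiv> mat_diag n (\<lambda>i. if i < r then s ! i else 0)"
  shows "Q \<in> stiefel n p" "Q * transpose_mat Q = B" "D * Q = rect_diag n p s" "D * B = D"
proof -
  have Rc: "R \<in> carrier_mat (n - r) (p - r)" using R by (simp add: stiefel_def)
  show Q: "Q \<in> stiefel n p" using block_stiefel[OF R, of r] pn r by (simp add: Q_def)
  show "Q * transpose_mat Q = B" unfolding Q_def B_def by (rule block_form_gram[OF Rc])
  have Qc: "Q \<in> carrier_mat n p" using Q by (simp add: stiefel_def)
  have Bc: "B \<in> carrier_mat n n" using pn r Rc by (auto simp: B_def intro!: carrier_matI)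
  have Q1: "Q $$ (i, j) = (if i = j then 1 else 0)" if "i < r" "j < p" for i j
    using that pn r Rc by (auto simp: Q_def)
  have B1: "B $$ (i, j) = (if i = j then 1 else 0)" if "i < r" "j < n" for i j
    using that pn r Rc by (auto simp: B_def)
  show "D * Q = rect_diag n p s"
    unfolding D_def mat_diag_mult_left[OF Qc] rect_diag_def
    by (rule eq_matI) (auto simp: Q1 s)
  show "D * B = D"
    unfolding D_def mat_diag_mult_left[OF Bc]
    by (rule eq_matI) (auto simp: B1 mat_diag_def)
qed

text \<open>Supplies the \<open>S\<close> of \<open>W_set\<close>: the positive singular values on
  the diagonal, padded with zeros.\<close>

lemma diag_in_pd_block_mats:
  assumes r: "r \<le> n" and d: "\<And>i. i < r \<Longrightarrow> 0 < d i"
  shows "mat_diag n (\<lambda>i. if i < r then d i else 0) \<in> pd_block_mats n r"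
proof -
  have "mat_diag n (\<lambda>i. if i < r then d i else 0) \<in> psd_mats n"
    by (rule mat_diag_psd) (auto dest: d)
  moreover have "mat_diag r d \<in> pd_mats r"
  proof -
    have "0 < x \<bullet> (mat_diag r d *\<^sub>v x)" if x: "x \<in> carrier_vec r" "x \<noteq> 0\<^sub>v r" for x
    proof -
      obtain i where i: "i < r" "x $ i \<noteq> 0" using x by (metis carrier_vecD eq_vecI index_zero_vec)
      have "x \<bullet> (mat_diag r d *\<^sub>v x) = (\<Sum>i<r. \<Sum>j<r. mat_diag r d $$ (i, j) * (x $ i * x $ j))"
        using x(1) by (intro quadratic_form_sum) auto
      also have "\<dots> = (\<Sum>i<r. \<Sum>j<r. if j = i then d i * (x $ i)\<^sup>2 else 0)"
        by (intro sum.cong refl) (auto simp: mat_diag_def power2_eq_square)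
      also have "\<dots> = (\<Sum>i<r. d i * (x $ i)\<^sup>2)" by simp
      also have "\<dots> > 0" using i d by (intro sum_pos2[of _ i]) (auto simp: less_imp_le)
      finally show ?thesis .
    qed
    moreover have "transpose_mat (mat_diag r d) = mat_diag r d"
      by (rule eq_matI) (auto simp: mat_diag_def)
    ultimately show ?thesis by (auto simp: pd_mats_def)
  qed
  moreover have "mat_diag n (\<lambda>i. if i < r then d i else 0) =
      four_block_mat (mat_diag r d) (0\<^sub>m r (n - r)) (0\<^sub>m (n - r) r) (0\<^sub>m (n - r) (n - r))"
    using r by (intro eq_matI) (auto simp: mat_diag_def)
  ultimately show ?thesis unfolding pd_block_mats_def by blast
qed

subsection \<open>Directions of constant nuclear norm\<close>

text \<open>Passing to the singular bases turns \<open>Q\<close> into \<open>Q'\<close>, which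
  maximizes the trace for the diagonal matrix \<open>D\<close> and so has block form. There
  \<open>P * Q'\<close> and \<open>S * Q'\<close> represent \<open>X\<close> and \<open>X0\<close>,
  and equal norms give \<open>P\<close> and \<open>S\<close> equal traces.\<close>

lemma maximizer_diff_in_W_set:
  assumes pn: "p \<le> n" and X0: "X0 \<in> carrier_mat n p" and svd: "is_svd n p X0 U V"
    and X: "X \<in> carrier_mat n p" and Q: "Q \<in> stiefel n p"
    and tr0: "trace_mat (transpose_mat Q * X0) = nuclear_norm X0"
    and tr: "trace_mat (transpose_mat Q * X) = nuclear_norm X"
    and eq: "nuclear_norm X = nuclear_norm X0"
  shows "X - X0 \<in> W_set n p X0 U V"
proof -
  define r where "r = vec_space.rank n X0"
  define s where "s = singular_values X0"
  define D where "D = rect_diag n p s"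
  define S where "S = mat_diag n (\<lambda>i. if i < r then s ! i else 0)"
  define Q' where "Q' = transpose_mat U * (Q * V)"
  note U = is_svdD(1)[OF svd] and V = is_svdD(2)[OF svd]
  have X0eq: "X0 = U * D * transpose_mat V" using is_svdD(3)[OF svd] by (simp add: D_def s_def)
  have [simp]: "dim_row D = n" "dim_col D = p" by (auto simp: D_def rect_diag_def)
  have [simp]: "dim_row S = n" "dim_col S = n" by (auto simp: S_def)
  note [simp] = stiefelD(1,2)[OF U] stiefelD(1,2)[OF V] stiefelD(1,2)[OF Q]
  have Q': "Q' \<in> stiefel n p"
    unfolding Q'_def by (intro stiefel_mult[of _ n n] stiefel_mult[OF Q V] stiefel_transpose[OF U])
  note [simp] = stiefelD(1,2)[OF Q']
  have r: "r \<le> p" and pos: "\<And>i. i < p \<Longrightarrow> 0 < s ! i \<longleftrightarrow> i < r"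
    using singular_values_pos_iff[OF pn X0 svd] by (auto simp: r_def s_def)
  have nonneg: "0 \<le> s ! i" if "i < p" for i
    using singular_values_nonneg[OF X0 that] by (simp add: s_def)
  have zero: "\<forall>i. r \<le> i \<longrightarrow> i < p \<longrightarrow> s ! i = 0"
    using nonneg pos by (meson antisym_conv2 not_less)
  have "trace_mat (transpose_mat Q' * D) = trace_mat (transpose_mat Q * X0)"
    using trace_mult_commute[of "transpose_mat V" "transpose_mat Q * (U * D)"]
    by (simp add: Q'_def X0eq mat_algebra)
  then have "trace_mat (transpose_mat Q' * D) = (\<Sum>i<p. s ! i)"
    using tr0 nuclear_norm_eq_sum[OF X0] by (simp add: s_def)
  then obtain R where R: "R \<in> stiefel (n - r) (p - r)"
    and Q'R: "Q' = four_block_mat (1\<^sub>m r) (0\<^sub>m r (p - r)) (0\<^sub>m (n - r) r) R"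
    using maximizer_block_form[OF Q' pn r nonneg pos] unfolding D_def by blast
  note block = block_mult_facts[OF pn r R zero, folded Q'R S_def D_def]
  let ?B = "four_block_mat (1\<^sub>m r) (0\<^sub>m r (n - r)) (0\<^sub>m (n - r) r) (R * transpose_mat R)"
  obtain H where H: "H \<in> psd_mats p" and XH: "X = Q * H" and trH: "trace_mat H = nuclear_norm X"
    using polar_of_maximizer[OF pn X Q tr] by blast
  note [simp] = psd_matsD(1,2)[OF H]
  \<comment> \<open>This is U^T X Q^T U; writing \<open>X\<close> as \<open>Q * H\<close> shows that
    it is psd.\<close>
  define P where "P = transpose_mat U * (Q * (H * transpose_mat Q) * U)"
  have [simp]: "dim_row P = n" "dim_col P = n" by (auto simp: P_def)
  have P: "P \<in> psd_mats n"
    using psd_congruence[OF psd_congruence[OF H, of "transpose_mat Q"], of U] by (simp add: P_def)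
  have S: "S \<in> pd_block_mats n r"
    unfolding S_def using diag_in_pd_block_mats[of r n "\<lambda>i. s ! i"] r pn pos by simp
  have PQ: "P * Q' = transpose_mat U * (X * V)"
    by (simp add: P_def Q'_def XH mat_algebra stiefel_cancel_right[OF U] stiefel_cancel[OF Q])
  \<comment> \<open>\<open>P * Q'\<close> is U^T X V, and multiplying by the transpose of
    \<open>Q'\<close> cancels \<open>V\<close>, which gives back \<open>P\<close>.\<close>
  have "P * (Q' * transpose_mat Q') = P"
    by (simp add: PQ flip: mult_assoc_dims)
      (simp add: Q'_def P_def XH mat_algebra stiefel_cancel_right[OF V])
  then have MB: "(P - S) * ?B = P - S"
    using block(4) by (simp add: left_minus_distrib_dims flip: block(2))
  have trP: "trace_mat P = nuclear_norm X"
    using trace_mult_commute[of "transpose_mat U" "Q * (H * transpose_mat Q) * U"]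
      trace_mult_commute[of "Q" "H * transpose_mat Q"] trH
    by (simp add: P_def mat_algebra stiefel_right_inverse[OF U] stiefelD(3)[OF Q])
  have "trace_mat S = (\<Sum>i<n. if i < r then s ! i else 0)"
    by (simp add: S_def trace_mat_def mat_diag_def)
  also have "\<dots> = (\<Sum>i<p. s ! i)"
    using r pn zero by (intro sum.mono_neutral_cong_right) auto
  finally have trM: "trace_mat (P - S) = 0"
    using trP eq nuclear_norm_eq_sum[OF X0] by (simp add: trace_minus s_def)
  have "U * (P - S) * Q' * transpose_mat V = U * (P * Q' - S * Q') * transpose_mat V"
    by (simp add: mat_algebra)
  also have "\<dots> = X - X0"
    unfolding PQ block(3) X0eq
    by (simp add: mat_algebra stiefel_cancel_right[OF U] stiefel_right_inverse[OF V] carrier_matD[OF X])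
  finally have "X - X0 = U * (P - S) * Q' * transpose_mat V" by simp
  with P S trM R MB show ?thesis
    unfolding W_set_def Let_def r_def[symmetric] Q'R by blast
qed

text \<open>For small \<open>t > 0\<close> the perturbed matrix keeps a psd polar factor, whose
  trace is unchanged because M has trace zero. One such \<open>t\<close> is enough: if
  \<open>Z\<close> is nonzero, it yields a second point of equal norm.\<close>

lemma W_set_nuclear_norm_constant:
  assumes pn: "p \<le> n" and X0: "X0 \<in> carrier_mat n p" and svd: "is_svd n p X0 U V"
    and Z: "Z \<in> W_set n p X0 U V"
  shows "Z \<in> carrier_mat n p \<and> (\<exists>t>0. nuclear_norm (X0 + t \<cdot>\<^sub>m Z) = nuclear_norm X0)"
proof -
  define r where "r = vec_space.rank n X0"
  define s where "s = singular_values X0"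
  define D where "D = rect_diag n p s"
  define d where "d = (\<lambda>i. if i < r then s ! i else 0)"
  define E where "E = mat_diag n d"
  note U = is_svdD(1)[OF svd] and V = is_svdD(2)[OF svd]
  have X0eq: "X0 = U * D * transpose_mat V" using is_svdD(3)[OF svd] by (simp add: D_def s_def)
  have [simp]: "dim_row D = n" "dim_col D = p" by (auto simp: D_def rect_diag_def)
  have [simp]: "dim_row E = n" "dim_col E = n" by (auto simp: E_def)
  note [simp] = stiefelD(1,2)[OF U] stiefelD(1,2)[OF V]
  have r: "r \<le> p" and pos: "\<And>i. i < p \<Longrightarrow> 0 < s ! i \<longleftrightarrow> i < r"
    using singular_values_pos_iff[OF pn X0 svd] by (auto simp: r_def s_def)
  have zero: "\<forall>i. r \<le> i \<longrightarrow> i < p \<longrightarrow> s ! i = 0"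
    using singular_values_nonneg[OF X0] pos unfolding s_def by (meson antisym_conv2 not_less)
  from Z obtain P S R where P: "P \<in> psd_mats n" and S: "S \<in> pd_block_mats n r"
    and trM: "trace_mat (P - S) = 0" and R: "R \<in> stiefel (n - r) (p - r)"
    and MB: "(P - S) * four_block_mat (1\<^sub>m r) (0\<^sub>m r (n - r)) (0\<^sub>m (n - r) r) (R * transpose_mat R) = P - S"
    and Zeq: "Z = U * (P - S) * four_block_mat (1\<^sub>m r) (0\<^sub>m r (p - r)) (0\<^sub>m (n - r) r) R * transpose_mat V"
    unfolding W_set_def Let_def r_def[symmetric] by blast
  define Q where "Q = four_block_mat (1\<^sub>m r) (0\<^sub>m r (p - r)) (0\<^sub>m (n - r) r) R"
  note block = block_mult_facts[OF pn r R zero, folded Q_def d_def E_def D_def]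
  note [simp] = stiefelD(1,2)[OF block(1)] psd_matsD(1,2)[OF P]
  from S obtain A where Sp: "S \<in> psd_mats n" and A: "A \<in> pd_mats r"
    and SA: "S = four_block_mat A (0\<^sub>m r (n - r)) (0\<^sub>m (n - r) r) (0\<^sub>m (n - r) (n - r))"
    unfolding pd_block_mats_def by blast
  note [simp] = psd_matsD(1,2)[OF Sp]
  \<comment> \<open>The smallest positive singular value; in rank zero there is none, and 1 serves
    as the positive bound.\<close>
  define m where "m = (if r = 0 then 1 else s ! (r - 1))"
  have "0 < m" using pos[of "r - 1"] r by (auto simp: m_def)
  moreover have "m \<le> d i" if "i < r" for i
    using that r singular_values_antimono[of i "r - 1" X0] singular_values_length[OF X0]
    by (auto simp: m_def d_def s_def)
  moreover have "0 \<le> d i" for i using pos[of i] r by (auto simp: d_def less_imp_le)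
  moreover have "A \<in> carrier_mat r r" "transpose_mat A = A" using A by (auto simp: pd_mats_def)
  ultimately obtain t where t: "0 < t" and ES: "E - t \<cdot>\<^sub>m S \<in> psd_mats n"
    using psd_minus_small_block[of A r n m d] r pn unfolding SA E_def by auto
  \<comment> \<open>Regrouped as \<open>E - t \<cdot>\<^sub>m S\<close> plus
    \<open>t \<cdot>\<^sub>m P\<close>, this is psd; the subtracted \<open>S\<close> is what
    requires \<open>t\<close> to be small.\<close>
  define N where "N = E + t \<cdot>\<^sub>m (P - S)"
  have [simp]: "dim_row N = n" "dim_col N = n" by (auto simp: N_def)
  have "N = (E - t \<cdot>\<^sub>m S) + t \<cdot>\<^sub>m P"
    by (rule eq_matI) (auto simp: N_def algebra_simps)
  then have N: "N \<in> psd_mats n" using psd_add[OF ES psd_smult[OF P]] t by simp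
  have NQQ: "N * (Q * transpose_mat Q) = N"
    using block(4) MB by (simp add: N_def left_distrib_dims smult_mult_dims flip: block(2))
  \<comment> \<open>Symmetry of \<open>N\<close> turns invariance under the projection on the right
    into invariance on the left. This is what makes \<open>N * Q\<close> equal to
    \<open>Q * H\<close> with \<open>H\<close> psd.\<close>
  have QQN: "Q * (transpose_mat Q * N) = N"
    using arg_cong[OF NQQ, of transpose_mat] by (simp add: mat_algebra psd_matsD(3)[OF N])
  define H where "H = transpose_mat Q * (N * Q)"
  have H: "H \<in> psd_mats p" using psd_congruence[OF N, of Q] by (simp add: H_def)
  note [simp] = psd_matsD(1,2)[OF H]
  have QH: "Q * H = N * Q"
    using QQN by (simp add: H_def flip: mult_assoc_dims)
  have Zc: "Z \<in> carrier_mat n p" by (auto simp: Zeq intro!: carrier_matI)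
  have "X0 + t \<cdot>\<^sub>m Z = U * (N * Q) * transpose_mat V"
    unfolding Zeq Q_def[symmetric] X0eq N_def
    by (simp add: mat_algebra block(3))
  \<comment> \<open>Inserting \<open>transpose_mat V * V\<close> splits the product into orthonormal
    columns times a psd matrix, so the norm can be read off as a trace.\<close>
  also have "\<dots> = (U * (Q * transpose_mat V)) * (V * (H * transpose_mat V))"
    by (simp add: mat_algebra stiefel_cancel[OF V] flip: QH)
  finally have XZ: "X0 + t \<cdot>\<^sub>m Z = (U * (Q * transpose_mat V)) * (V * (H * transpose_mat V))" .
  have "U * (Q * transpose_mat V) \<in> stiefel n p"
    by (intro stiefel_mult[OF U] stiefel_mult[OF block(1)] stiefel_transpose[OF V])
  moreover have "V * (H * transpose_mat V) \<in> psd_mats p"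
    using psd_congruence[OF H, of "transpose_mat V"] by simp
  ultimately have "nuclear_norm (X0 + t \<cdot>\<^sub>m Z) = trace_mat (V * (H * transpose_mat V))"
    unfolding XZ by (rule nuclear_norm_polar[OF pn])
  also have "\<dots> = trace_mat H"
    using trace_mult_commute[of V "H * transpose_mat V"] by (simp add: mat_algebra stiefelD(3)[OF V])
  also have "\<dots> = trace_mat N"
    using trace_mult_commute[of "transpose_mat Q" "N * Q"] NQQ by (simp add: H_def mat_algebra)
  also have "\<dots> = trace_mat E"
    using trM by (simp add: N_def trace_add trace_smult)
  also have "\<dots> = (\<Sum>i<n. if i < r then s ! i else 0)"
    by (simp add: E_def d_def trace_mat_def mat_diag_def)
  also have "\<dots> = (\<Sum>i<p. s ! i)"
    using r pn zero by (intro sum.mono_neutral_cong_right) auto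
  also have "\<dots> = nuclear_norm X0" using nuclear_norm_eq_sum[OF X0] by (simp add: s_def)
  finally show ?thesis using Zc t by blast
qed

text \<open>Zero is the difference of \<open>X0\<close> with itself, and any maximizer for
  \<open>X0\<close> applies.\<close>

lemma zero_in_W_set:
  assumes "p \<le> n" "X0 \<in> carrier_mat n p" "is_svd n p X0 U V"
  shows "0\<^sub>m n p \<in> W_set n p X0 U V"
proof -
  obtain Q where Q: "Q \<in> stiefel n p" "trace_mat (transpose_mat Q * X0) = nuclear_norm X0"
    using nuclear_norm_attained[OF assms(1,2)] by blast
  have "X0 - X0 = 0\<^sub>m n p" using assms(2) by (intro eq_matI) auto
  then show ?thesis using maximizer_diff_in_W_set[OF assms(1-3,2) Q(1,2,2)] by simp
qed

section \<open>Unique solvability and the kernel condition\<close>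

theorem corollary4p10:
  fixes n p :: nat
    and \<A> :: "real mat \<Rightarrow> 'e::real_inner"
    and b :: 'e
    and f :: "'e \<Rightarrow> real"
    and reg :: real
    and Xbar :: "real mat"
  assumes "0 < p" and "p \<le> n"
    and "\<exists>B :: 'e set. finite B \<and> span B = UNIV"
    and "linear_on_mats n p \<A>"
    and "reg > 0"
    and "strictly_convex f"
    and "Xbar \<in> solutions n p \<A> b f reg"
  shows "(solutions n p \<A> b f reg = {Xbar} \<longleftrightarrow>
            {X \<in> carrier_mat n p. \<A> X = \<A> Xbar \<and> nuclear_norm X = nuclear_norm Xbar} = {Xbar}) \<and>
         (\<forall>U V. is_svd n p Xbar U V \<longrightarrow>
            ({X \<in> carrier_mat n p. \<A> X = \<A> Xbar \<and> nuclear_norm X = nuclear_norm Xbar} = {Xbar} \<longleftrightarrow>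
             W_set n p Xbar U V \<inter> {X \<in> carrier_mat n p. \<A> X = 0} = {0\<^sub>m n p}))"
proof -
  let ?F = "\<lambda>X. f (\<A> X - b) + reg * nuclear_norm X"
  let ?C = "{X \<in> carrier_mat n p. \<A> X = \<A> Xbar \<and> nuclear_norm X = nuclear_norm Xbar}"
  have sol: "X \<in> solutions n p \<A> b f reg \<longleftrightarrow> X \<in> carrier_mat n p \<and> (\<forall>Y \<in> carrier_mat n p. ?F X \<le> ?F Y)" for X
    by (auto simp: solutions_def is_arg_min_def not_less)
  have Xbar: "Xbar \<in> carrier_mat n p" and opt: "\<And>Y. Y \<in> carrier_mat n p \<Longrightarrow> ?F Xbar \<le> ?F Y"
    using assms(7) by (auto simp: sol)
  have add: "\<A> (X + Y) = \<A> X + \<A> Y" if "X \<in> carrier_mat n p" "Y \<in> carrier_mat n p" for X Y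
    using assms(4) that by (auto simp: linear_on_mats_def)
  have smult: "\<A> (c \<cdot>\<^sub>m X) = c *\<^sub>R \<A> X" if "X \<in> carrier_mat n p" for X c
    using assms(4) that by (auto simp: linear_on_mats_def)
  have zero: "\<A> (0\<^sub>m n p) = 0"
  proof -
    have "(0::real) \<cdot>\<^sub>m 0\<^sub>m n p = 0\<^sub>m n p" by (rule eq_matI) auto
    then show ?thesis using smult[of "0\<^sub>m n p" 0] by simp
  qed
  have mid: "\<A> ((1/2) \<cdot>\<^sub>m (X + Xbar)) = (1/2) *\<^sub>R \<A> X + (1/2) *\<^sub>R \<A> Xbar"
    "(1/2) \<cdot>\<^sub>m (X + Xbar) \<in> carrier_mat n p" if "X \<in> carrier_mat n p" for X
    using that Xbar by (auto simp: smult add scaleR_add_right)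
  \<comment> \<open>If the images differed, strict convexity of \<open>f\<close> at the midpoint and
    the midpoint bound for the norm would give a value below the minimum. Once the images agree,
    equal objective values and \<open>reg > 0\<close> force equal norms.\<close>
  have "X \<in> ?C" if X: "X \<in> solutions n p \<A> b f reg" for X
  proof -
    have Xc: "X \<in> carrier_mat n p" and "?F X \<le> ?F Xbar" using X Xbar by (auto simp: sol)
    with opt[OF Xc] have FX: "?F X = ?F Xbar" by simp
    let ?M = "(1/2) \<cdot>\<^sub>m (X + Xbar)"
    obtain Q where Q: "Q \<in> stiefel n p" and "2 * nuclear_norm ?M =
        trace_mat (transpose_mat Q * X) + trace_mat (transpose_mat Q * Xbar)"
      using nuclear_norm_midpoint[OF assms(2) Xc Xbar] by blast
    then have nn: "2 * nuclear_norm ?M \<le> nuclear_norm X + nuclear_norm Xbar"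
      using trace_stiefel_le_nuclear_norm[OF assms(2) Xc Q] trace_stiefel_le_nuclear_norm[OF assms(2) Xbar Q]
      by simp
    have "\<A> X = \<A> Xbar"
    proof (rule ccontr)
      assume "\<A> X \<noteq> \<A> Xbar"
      then have "\<A> Xbar - b \<noteq> \<A> X - b" by simp
      moreover have "\<forall>t\<in>{0<..<1}. \<A> Xbar - b \<noteq> \<A> X - b \<longrightarrow>
          f ((1 - t) *\<^sub>R (\<A> Xbar - b) + t *\<^sub>R (\<A> X - b)) < (1 - t) * f (\<A> Xbar - b) + t * f (\<A> X - b)"
        using assms(6) unfolding strictly_convex_def by blast
      ultimately have "f ((1/2) *\<^sub>R (\<A> Xbar - b) + (1/2) *\<^sub>R (\<A> X - b)) <
          (1/2) * f (\<A> Xbar - b) + (1/2) * f (\<A> X - b)"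
        by (auto dest: bspec[of _ _ "1/2"])
      moreover have "(1/2) *\<^sub>R (\<A> Xbar - b) + (1/2) *\<^sub>R (\<A> X - b) =
          \<A> ?M - ((1/2) *\<^sub>R b + (1/2) *\<^sub>R b)"
        by (simp add: mid(1)[OF Xc] scaleR_diff_right)
      moreover have "(1/2) *\<^sub>R b + (1/2) *\<^sub>R b = b" by (simp flip: scaleR_add_left)
      ultimately have "2 * f (\<A> ?M - b) < f (\<A> Xbar - b) + f (\<A> X - b)" by simp
      moreover have "2 * (reg * nuclear_norm ?M) \<le> reg * nuclear_norm X + reg * nuclear_norm Xbar"
        using mult_left_mono[OF nn, of reg] assms(5) by (simp add: algebra_simps)
      ultimately have "2 * ?F ?M < ?F X + ?F Xbar" by simp
      with FX opt[OF mid(2)[OF Xc]] show False by simp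
    qed
    with FX assms(5) Xc show ?thesis by simp
  qed
  \<comment> \<open>Equal image and norm mean equal objective value. Hence the solution set is
    \<open>?C\<close>, and it remains to compare \<open>?C\<close> with
    \<open>W_set\<close>.\<close>
  moreover have "X \<in> solutions n p \<A> b f reg" if "X \<in> ?C" for X
    using that opt by (simp add: sol)
  ultimately have "solutions n p \<A> b f reg = ?C" by blast
  moreover have "?C = {Xbar} \<longleftrightarrow> W_set n p Xbar U V \<inter> {X \<in> carrier_mat n p. \<A> X = 0} = {0\<^sub>m n p}"
    if svd: "is_svd n p Xbar U V" for U V
  proof
    assume C: "?C = {Xbar}"
    \<comment> \<open>Moving from \<open>Xbar\<close> by \<open>t\<close> times \<open>Z\<close>
      changes neither image nor norm, so the new point lies in \<open>?C\<close> and
      \<open>Z\<close> must vanish.\<close>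
    have "Z = 0\<^sub>m n p" if Z: "Z \<in> W_set n p Xbar U V" "\<A> Z = 0" for Z
    proof -
      obtain t where Zc: "Z \<in> carrier_mat n p" and t: "0 < t"
        "nuclear_norm (Xbar + t \<cdot>\<^sub>m Z) = nuclear_norm Xbar"
        using W_set_nuclear_norm_constant[OF assms(2) Xbar svd Z(1)] by blast
      then have "Xbar + t \<cdot>\<^sub>m Z \<in> ?C" using Z(2) Xbar by (simp add: add smult)
      then have "Xbar + t \<cdot>\<^sub>m Z = Xbar" using C by blast
      then have "(Xbar + t \<cdot>\<^sub>m Z) $$ (i, j) = Xbar $$ (i, j)" for i j by simp
      moreover have "(Xbar + t \<cdot>\<^sub>m Z) $$ (i, j) = Xbar $$ (i, j) + t * Z $$ (i, j)"
        if "i < n" "j < p" for i j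
        using that Zc Xbar by simp
      ultimately have "Z $$ (i, j) = 0" if "i < n" "j < p" for i j
        using that t(1) by fastforce
      then show ?thesis using Zc by (intro eq_matI) auto
    qed
    then show "W_set n p Xbar U V \<inter> {X \<in> carrier_mat n p. \<A> X = 0} = {0\<^sub>m n p}"
      using zero zero_in_W_set[OF assms(2) Xbar svd] zero_carrier_mat[of n p] by blast
  next
    assume W: "W_set n p Xbar U V \<inter> {X \<in> carrier_mat n p. \<A> X = 0} = {0\<^sub>m n p}"
    have "X = Xbar" if X: "X \<in> carrier_mat n p" "\<A> X = \<A> Xbar" "nuclear_norm X = nuclear_norm Xbar" for X
    proof -
      let ?M = "(1/2) \<cdot>\<^sub>m (X + Xbar)"
      obtain Q where Q: "Q \<in> stiefel n p" and trQ: "2 * nuclear_norm ?M =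
          trace_mat (transpose_mat Q * X) + trace_mat (transpose_mat Q * Xbar)"
        using nuclear_norm_midpoint[OF assms(2) X(1) Xbar] by blast
      \<comment> \<open>The midpoint has the same image as \<open>Xbar\<close>, so optimality of
        \<open>Xbar\<close> bounds its norm from below. Together with the two trace bounds this
        forces \<open>Q\<close> to attain both norms.\<close>
      have "\<A> ?M = \<A> Xbar" using mid(1)[OF X(1)] X(2) by (simp flip: scaleR_add_left)
      then have "nuclear_norm Xbar \<le> nuclear_norm ?M"
        using opt[OF mid(2)[OF X(1)]] assms(5) by simp
      then have "trace_mat (transpose_mat Q * X) = nuclear_norm X"
        "trace_mat (transpose_mat Q * Xbar) = nuclear_norm Xbar"
        using trQ X(3) trace_stiefel_le_nuclear_norm[OF assms(2) X(1) Q]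
          trace_stiefel_le_nuclear_norm[OF assms(2) Xbar Q] by simp_all
      then have "X - Xbar \<in> W_set n p Xbar U V"
        using maximizer_diff_in_W_set[OF assms(2) Xbar svd X(1) Q] X(3) by blast
      moreover have "X - Xbar = X + (-1) \<cdot>\<^sub>m Xbar" using X(1) Xbar by (intro eq_matI) auto
      then have "\<A> (X - Xbar) = 0" using X Xbar by (simp add: add smult)
      ultimately have "X - Xbar = 0\<^sub>m n p" using W minus_carrier_mat[OF Xbar] by blast
      then have "(X - Xbar) $$ (i, j) = 0" if "i < n" "j < p" for i j using that by simp
      moreover have "(X - Xbar) $$ (i, j) = X $$ (i, j) - Xbar $$ (i, j)" if "i < n" "j < p" for i j
        using that X(1) Xbar by simp
      ultimately have "X $$ (i, j) = Xbar $$ (i, j)" if "i < n" "j < p" for i j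
        using that by (metis eq_iff_diff_eq_0)
      then show ?thesis using X(1) Xbar by (intro eq_matI) auto
    qed
    then show "?C = {Xbar}" using Xbar by blast
  qed
  ultimately show ?thesis by simp
qed

end
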